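(* Let $N\ge 3$ be an integer. The weighted Sobolev space $W^{1,N}_{w}(\mathbb{R}^N)$ embeds into the weighted Orlicz space $L_{\phi_N}(\mathbb{R}^N,\log(e+|x|)\,dx)$, where $$\phi_N(t)=e^{t}-\sum_{j=0}^{N-2}\frac{t^j}{j!}.$$ More precisely, $$\int_{\mathbb{R}^N}\phi_N\left(\alpha|u|^{\frac{N}{N-1}}\right)\log(e+|x|)\,dx<\infty$$ for every $u\in W^{1,N}_{w}(\mathbb{R}^N)$ and every $\alpha>0$. Moreover, the following uniform bound holds: $$\sup_{\|u\|_{w}^N\le 1}\int_{\mathbb{R}^N}\phi_N\left(\alpha_N\left(\frac{N}{N+1}\right)^{1/(N-1)}|u|^{\frac{N}{N-1}}\right)\log(e+|x|)\,dx<+\infty,$$ where $\alpha_N=N\omega_{N-1}^{\frac{1}{N-1}}$ and the supremum is over $u\in W^{1,N}_w(\mathbb{R}^N)$.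
   Context: $\omega_{N-1}$ denotes the $(N-1)$-dimensional surface measure of the unit sphere in $\mathbb{R}^N$. The space $W^{1,N}_{w}(\mathbb{R}^N)$, with weight $w(x)=\log(e+|x|)$, is the completion of the smooth compactly supported functions on $\mathbb{R}^N$ with respect to the norm $\|\cdot\|_w$ given by $$\|u\|_{w}^N=\int_{\mathbb{R}^N}|\nabla u|^N\,dx+\int_{\mathbb{R}^N}|u|^N\log(e+|x|)\,dx.$$ The weighted Orlicz space $L_{\phi_N}(\mathbb{R}^N,\log(e+|x|)\,dx)$ is the Orlicz space, with respect to the measure $\log(e+|x|)\,dx$, associated with the Young function $t\mapsto\phi_N(|t|^{N/(N-1)})$. *)

theory Defs
  imports "HOL-Analysis.Analysis"
begin

text \<open>Throughout, \<open>N = CARD('n)\<close> is the dimension of \<open>real ^ 'n\<close>. Functions are concrete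
  representatives of their almost-everywhere classes and are Lebesgue measurable.\<close>

section \<open>Surface measure of the unit sphere\<close>

text \<open>The surface measure of a subset of the unit sphere is \<open>N\<close> times the volume of the cone
  over it, which is the measure \<open>\<sigma>\<close> in \<open>dx = r ^ (N - 1) dr d\<sigma>\<close>.\<close>

definition sphere_surface_measure :: "(real ^ 'n) set \<Rightarrow> real" where
  "sphere_surface_measure A =
     real CARD('n) * measure lebesgue {t *\<^sub>R x | t x. 0 < t \<and> t < 1 \<and> x \<in> A}"

definition sphere_area :: "'n::finite itself \<Rightarrow> real" where
  "sphere_area _ = sphere_surface_measure (sphere (0 :: real ^ 'n) 1)"


section \<open>Test functions and gradients\<close>

definition partial_deriv :: "'n \<Rightarrow> (real ^ 'n \<Rightarrow> real) \<Rightarrow> real ^ 'n \<Rightarrow> real" where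
  "partial_deriv i f x = frechet_derivative f (at x) (axis i 1)"

definition grad :: "(real ^ 'n \<Rightarrow> real) \<Rightarrow> real ^ 'n \<Rightarrow> real ^ 'n" where
  "grad f x = (\<chi> i. partial_deriv i f x)"

primrec Ck :: "nat \<Rightarrow> (real ^ 'n \<Rightarrow> real) \<Rightarrow> bool" where
  "Ck 0 f \<longleftrightarrow> continuous_on UNIV f"
| "Ck (Suc k) f \<longleftrightarrow> (\<forall>x. f differentiable (at x)) \<and> (\<forall>i. Ck k (partial_deriv i f))"

definition test_function :: "(real ^ 'n \<Rightarrow> real) \<Rightarrow> bool" where
  "test_function f \<longleftrightarrow> (\<forall>k. Ck k f) \<and> compact (closure {x. f x \<noteq> 0})"


section \<open>The weighted Sobolev space\<close>

definition log_weight :: "real ^ 'n \<Rightarrow> real" where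
  "log_weight x = ln (exp 1 + norm x)"

text \<open>The \<open>N\<close>-th power of the weighted norm of a function \<open>u\<close> whose gradient is \<open>G\<close>.\<close>

definition w_energy :: "(real ^ 'n \<Rightarrow> real) \<Rightarrow> (real ^ 'n \<Rightarrow> real ^ 'n) \<Rightarrow> ennreal" where
  "w_energy u G =
     (\<integral>\<^sup>+ x. ennreal (norm (G x) ^ CARD('n)) \<partial>lebesgue) +
     (\<integral>\<^sup>+ x. ennreal (\<bar>u x\<bar> ^ CARD('n) * log_weight x) \<partial>lebesgue)"

text \<open>The map sending a test function \<open>f\<close> to \<open>(f, grad f)\<close> is an isometry from the test functions
  into the product of the Banach spaces \<open>L\<^sup>N(log_weight x dx)\<close> and \<open>L\<^sup>N(dx)\<close>; so the completion of the
  test functions is the closure of its image. An element of the closure is a pair \<open>(u, G)\<close>.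
  Here \<open>G\<close> is the weak gradient of \<open>u\<close>, so it is determined by \<open>u\<close> almost everywhere, the completion
  is a space of functions \<open>u\<close>, and the choice made in \<open>w_grad\<close> affects neither the norm nor
  anything else below.\<close>

definition w_limit :: "(real ^ 'n \<Rightarrow> real) \<Rightarrow> (real ^ 'n \<Rightarrow> real ^ 'n) \<Rightarrow> bool" where
  "w_limit u G \<longleftrightarrow>
     u \<in> borel_measurable lebesgue \<and> G \<in> borel_measurable lebesgue \<and>
     (\<exists>f :: nat \<Rightarrow> real ^ 'n \<Rightarrow> real. (\<forall>k. test_function (f k)) \<and>
        (\<lambda>k. w_energy (\<lambda>x. f k x - u x) (\<lambda>x. grad (f k) x - G x)) \<longlonglongrightarrow> 0)"

definition W1N_w :: "(real ^ 'n \<Rightarrow> real) set" where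
  "W1N_w = {u. \<exists>G. w_limit u G}"

definition w_grad :: "(real ^ 'n \<Rightarrow> real) \<Rightarrow> real ^ 'n \<Rightarrow> real ^ 'n" where
  "w_grad u = (SOME G. w_limit u G)"

text \<open>The energy is finite for \<open>u \<in> W1N_w\<close>; the norm is used for such \<open>u\<close> only.\<close>

definition w_norm :: "(real ^ 'n \<Rightarrow> real) \<Rightarrow> real" where
  "w_norm u = root CARD('n) (enn2real (w_energy u (w_grad u)))"


section \<open>Orlicz spaces\<close>

definition orlicz_modular :: "'a measure \<Rightarrow> (real \<Rightarrow> real) \<Rightarrow> ('a \<Rightarrow> real) \<Rightarrow> ennreal" where
  "orlicz_modular M \<Phi> u = (\<integral>\<^sup>+ x. ennreal (\<Phi> (u x)) \<partial>M)"

definition orlicz_space :: "'a measure \<Rightarrow> (real \<Rightarrow> real) \<Rightarrow> ('a \<Rightarrow> real) set" where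
  "orlicz_space M \<Phi> =
     {u \<in> borel_measurable M. \<exists>r>0. orlicz_modular M \<Phi> (\<lambda>x. u x / r) < \<infinity>}"

text \<open>The Luxemburg norm. It takes values in \<open>ennreal\<close>, so that an empty infimum is \<open>\<infinity>\<close>.\<close>

definition luxemburg_norm :: "'a measure \<Rightarrow> (real \<Rightarrow> real) \<Rightarrow> ('a \<Rightarrow> real) \<Rightarrow> ennreal" where
  "luxemburg_norm M \<Phi> u =
     (INF r \<in> {r. 0 < r \<and> orlicz_modular M \<Phi> (\<lambda>x. u x / r) \<le> 1}. ennreal r)"

definition phi :: "nat \<Rightarrow> real \<Rightarrow> real" where
  "phi N t = exp t - (\<Sum>j = 0..N - 2. t ^ j / fact j)"

definition young_phi :: "nat \<Rightarrow> real \<Rightarrow> real" where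
  "young_phi N t = phi N (\<bar>t\<bar> powr (real N / (real N - 1)))"

definition log_measure :: "(real ^ 'n) measure" where
  "log_measure = density lebesgue (\<lambda>x. ennreal (log_weight x))"

definition alpha_N :: "'n::finite itself \<Rightarrow> real" where
  "alpha_N n = real CARD('n) * sphere_area n powr (1 / (real CARD('n) - 1))"

end

theory Submission
  imports Defs
begin

text \<open>Fix \<open>\<beta> < \<alpha>\<^sub>N\<close>; the exponent in the uniform bound is of this kind, so neither symmetrisation nor the
  critical Moser inequality is needed. Averaging the fundamental theorem of calculus over rays from
  \<open>x\<close>, with a linear cut-off at distance \<open>\<rho>\<close>, gives
  \<open>\<omega> \<bar>f x\<bar> \<le> \<integral> (\<bar>\<nabla>f\<bar> + \<bar>f\<bar> / \<rho>) \<bar>y - x\<bar> powr (1 - N) dy\<close> over the ball of radius \<open>\<rho>\<close> around \<open>x\<close>.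
  With \<open>\<rho> = R * log_weight x powr (- 1 / N)\<close> and \<open>R\<close> large, the \<open>N\<close>-th power of \<open>\<bar>\<nabla>f\<bar> + \<bar>f\<bar> / \<rho>\<close> is at most
  \<open>(1 + \<epsilon>) ^ (N - 1)\<close> times the energy density \<open>e\<close> of the weighted norm. Hoelder's inequality with the weight
  \<open>(1 + l * (\<bar>y - x\<bar> / \<rho>) powr - a) ^ (N - 1)\<close>, and \<open>l\<close> chosen depending on \<open>x\<close>, then bounds
  \<open>exp (\<beta> * \<bar>f x\<bar> powr (N / (N - 1)))\<close> by a constant times \<open>max 1 (g x)\<close>, where \<open>g\<close> is the potential of \<open>e\<close>
  with kernel \<open>(\<bar>y - x\<bar> / \<rho>) powr - s\<close>, \<open>s < N\<close>. The choice of \<open>\<rho>\<close> makes the integral of \<open>g * log_weight\<close>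
  bounded by a multiple of the energy, and where \<open>g\<close> does not dominate, \<open>f\<close> is bounded and \<open>phi N\<close> is compared
  with \<open>\<bar>f\<bar> ^ N\<close>. Fatou's lemma passes to the completion, and arbitrary \<open>\<alpha>\<close> follow by splitting off a bounded
  test function.\<close>

section \<open>Polar integration and the Hoelder inequality\<close>

text \<open>Jensen's inequality for the power \<open>Suc k\<close> and the weights
  \<open>1 / (1 + h)\<close> and \<open>h / (1 + h)\<close>, cleared of denominators. It later
  separates the gradient from the cut-off term, splits the Hoelder weight, and bounds the energy of
  a sum.\<close>

lemma convex_combination_power_le:
  fixes a b h :: real
  assumes "0 \<le> a" "0 \<le> b" "0 < h"
  shows "(a + h * b) ^ Suc k \<le> (1 + h) ^ k * (a ^ Suc k + h * b ^ Suc k)"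
proof (induction k)
  case 0
  then show ?case by simp
next
  case (Suc k)
  \<comment> \<open>The difference of the two sides is
    \<open>h * ((a - b) * (a ^ Suc k - b ^ Suc k))\<close>, whose last two factors have the same
    sign.\<close>
  have *: "(a + h * b) * (a ^ Suc k + h * b ^ Suc k) \<le> (1 + h) * (a ^ Suc (Suc k) + h * b ^ Suc (Suc k))"
  proof -
    have "0 \<le> (a - b) * (a ^ Suc k - b ^ Suc k)"
    proof (cases "a \<le> b")
      case True
      then have "a ^ Suc k \<le> b ^ Suc k" by (intro power_mono assms)
      with True show ?thesis by (simp add: mult_nonpos_nonpos)
    next
      case False
      then have "b ^ Suc k \<le> a ^ Suc k" by (intro power_mono assms) auto
      with False show ?thesis by simp
    qed
    then have "0 \<le> h * ((a - b) * (a ^ Suc k - b ^ Suc k))" using assms by simp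
    then show ?thesis by (simp add: algebra_simps)
  qed
  have "(a + h * b) ^ Suc (Suc k) \<le> (a + h * b) * ((1 + h) ^ k * (a ^ Suc k + h * b ^ Suc k))"
    using Suc assms by (simp add: mult_left_mono)
  also have "\<dots> = (1 + h) ^ k * ((a + h * b) * (a ^ Suc k + h * b ^ Suc k))" by simp
  also have "\<dots> \<le> (1 + h) ^ k * ((1 + h) * (a ^ Suc (Suc k) + h * b ^ Suc (Suc k)))"
    using * assms by (intro mult_left_mono) auto
  finally show ?case by (simp add: mult_ac)
qed

lemma nn_integral_lborel_scaleR:
  fixes f :: "'a::euclidean_space \<Rightarrow> ennreal"
  assumes [measurable]: "f \<in> borel_measurable borel" and c: "c \<noteq> 0"
  shows "(\<integral>\<^sup>+x. f x \<partial>lborel) = ennreal (\<bar>c\<bar> ^ DIM('a)) * (\<integral>\<^sup>+x. f (c *\<^sub>R x) \<partial>lborel)"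
  by (subst lborel_affine[OF c, of 0])
     (simp add: nn_integral_density nn_integral_distr nn_integral_cmult)

lemma nn_integral_lborel_translation:
  fixes f :: "'a::euclidean_space \<Rightarrow> ennreal"
  assumes [measurable]: "f \<in> borel_measurable borel"
  shows "(\<integral>\<^sup>+x. f x \<partial>lborel) = (\<integral>\<^sup>+x. f (t + x) \<partial>lborel)"
  by (subst lborel_distr_plus[of t, symmetric]) (simp add: nn_integral_distr)

lemma nn_integral_powr_tail:
  fixes r :: real
  assumes "0 < r" "0 < n"
  shows "(\<integral>\<^sup>+t. ennreal (t powr (- n - 1)) * indicator {r<..} t \<partial>lborel) = ennreal (r powr - n / n)"
proof -
  have "(\<integral>\<^sup>+t. ennreal (t powr (- n - 1)) * indicator {r<..} t \<partial>lborel)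
      = (\<integral>\<^sup>+t. ennreal (t powr (- n - 1)) * indicator {r..} t \<partial>lborel)"
    by (rule nn_integral_cong_AE, rule eventually_mono[OF AE_lborel_singleton[of r]]) (auto simp: indicator_def)
  also have "\<dots> = ennreal (0 - (- (r powr - n) / n))"
  proof (rule nn_integral_FTC_atLeast)
    show "((\<lambda>t. - (t powr - n) / n) \<longlongrightarrow> 0) at_top"
    proof -
      have "((\<lambda>t::real. t powr - n) \<longlongrightarrow> 0) at_top"
        using assms by (intro tendsto_neg_powr filterlim_ident) auto
      then have "((\<lambda>t::real. - (t powr - n) / n) \<longlongrightarrow> - 0 / n) at_top"
        using assms by (intro tendsto_intros) auto
      then show ?thesis by simp
    qed
    show "DERIV (\<lambda>t. - (t powr - n) / n) x :> x powr (- n - 1)" if "r \<le> x" for x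
      using assms that by (auto intro!: derivative_eq_intros)
  qed auto
  finally show ?thesis by simp
qed

text \<open>Integration in polar coordinates without a measure on the sphere: the directions are
  parametrised by the points \<open>z\<close> of the unit ball.\<close>

lemma nn_integral_rays:
  fixes \<Phi> :: "'a::euclidean_space \<Rightarrow> ennreal"
  assumes [measurable]: "\<Phi> \<in> borel_measurable borel"
  shows "(\<integral>\<^sup>+y. ennreal (norm y powr (1 - real DIM('a))) * \<Phi> y \<partial>lborel) =
    ennreal (real DIM('a)) * (\<integral>\<^sup>+z. (\<integral>\<^sup>+t. ennreal (norm z) * \<Phi> (t *\<^sub>R z) * indicator {0<..} t \<partial>lborel)
        * indicator (ball 0 1) z \<partial>lborel)"
proof -
  let ?n = "real DIM('a)"
  \<comment> \<open>For fixed \<open>t\<close>, the substitution \<open>y = t *\<^sub>R z\<close>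
    maps the unit ball to \<open>norm y < t\<close>; the Jacobian \<open>t powr - ?n\<close> and
    \<open>norm z = norm y / t\<close> together give \<open>t powr (- ?n - 1)\<close>.\<close>
  let ?K = "\<lambda>t (y::'a). if norm y < t then ennreal (t powr (- ?n - 1)) * (ennreal (norm y) * \<Phi> y) else 0"
  have [measurable]: "ball (0::'a) 1 \<in> sets borel" by simp
  have K_measurable: "?K t \<in> borel_measurable borel" for t
    by measurable
  have K_scaled: "(\<lambda>z. ?K t (t *\<^sub>R z)) \<in> borel_measurable lborel" for t
    by measurable
  have scale: "(\<integral>\<^sup>+z. ennreal (norm z) * \<Phi> (t *\<^sub>R z) * indicator {0<..} t * indicator (ball 0 1) z \<partial>lborel)
      = (\<integral>\<^sup>+y. ?K t y \<partial>lborel)" for t :: real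
  proof (cases "0 < t")
    case True
    have "(\<integral>\<^sup>+y. ?K t y \<partial>lborel) = ennreal (\<bar>t\<bar> ^ DIM('a)) * (\<integral>\<^sup>+z. ?K t (t *\<^sub>R z) \<partial>lborel)"
      using True by (intro nn_integral_lborel_scaleR[OF K_measurable]) simp
    also have "\<dots> = (\<integral>\<^sup>+z. ennreal (t ^ DIM('a)) * ?K t (t *\<^sub>R z) \<partial>lborel)"
      using True by (simp only: nn_integral_cmult[OF K_scaled] abs_of_pos)
    also have "\<dots> = (\<integral>\<^sup>+z. ennreal (norm z) * \<Phi> (t *\<^sub>R z) * indicator {0<..} t * indicator (ball 0 1) z \<partial>lborel)"
    proof (intro nn_integral_cong)
      fix z :: 'a
      have "t ^ DIM('a) * (t powr (- ?n - 1) * (t * norm z)) = norm z"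
      proof -
        have "t ^ DIM('a) * (t powr (- ?n - 1) * t) = t powr (?n + (- ?n - 1) + 1)"
          using True by (simp only: powr_add powr_realpow[OF True]) simp
        also have "\<dots> = 1" using True by simp
        finally show ?thesis by (simp add: mult_ac)
      qed
      then have "ennreal (norm z) = ennreal (t ^ DIM('a)) * (ennreal (t powr (- ?n - 1)) * ennreal (t * norm z))"
        using True by (simp add: ennreal_mult'[symmetric])
      then show "ennreal (t ^ DIM('a)) * ?K t (t *\<^sub>R z)
          = ennreal (norm z) * \<Phi> (t *\<^sub>R z) * indicator {0<..} t * indicator (ball 0 1) z"
        using True by (auto simp: indicator_def dist_norm mult_ac)
    qed
    finally show ?thesis ..
  next
    case False
    then have "\<not> norm y < t" for y :: 'a
      using norm_ge_zero[of y] by linarith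
    with False show ?thesis by simp
  qed
  \<comment> \<open>Once the integrals are exchanged, the tail of \<open>t powr (- ?n - 1)\<close>
    beyond \<open>norm y\<close> contributes \<open>norm y powr - ?n / ?n\<close>, and the factor
    \<open>norm y\<close> turns this into the wanted kernel. At \<open>y = 0\<close> both sides
    vanish, because \<open>0 powr r = 0\<close>.\<close>
  have inner: "(\<integral>\<^sup>+t. ?K t y \<partial>lborel) = ennreal (1 / ?n) * (ennreal (norm y powr (1 - ?n)) * \<Phi> y)" for y
  proof (cases "y = 0")
    case False
    have "(\<integral>\<^sup>+t. ?K t y \<partial>lborel)
        = (\<integral>\<^sup>+t. ennreal (t powr (- ?n - 1)) * indicator {norm y<..} t * (ennreal (norm y) * \<Phi> y) \<partial>lborel)"
      by (intro nn_integral_cong) (auto simp: indicator_def)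
    also have "\<dots> = (\<integral>\<^sup>+t. ennreal (t powr (- ?n - 1)) * indicator {norm y<..} t \<partial>lborel) * (ennreal (norm y) * \<Phi> y)"
      by (rule nn_integral_multc) measurable
    also have "\<dots> = ennreal (norm y powr - ?n / ?n) * ennreal (norm y) * \<Phi> y"
      using False by (subst nn_integral_powr_tail) (auto simp: mult_ac)
    also have "ennreal (norm y powr - ?n / ?n) * ennreal (norm y) = ennreal (1 / ?n) * ennreal (norm y powr (1 - ?n))"
      using False by (simp add: ennreal_mult'[symmetric] powr_diff powr_minus field_simps)
    finally show ?thesis by (simp add: mult_ac)
  qed (simp cong: if_cong)
  have "(\<integral>\<^sup>+z. (\<integral>\<^sup>+t. ennreal (norm z) * \<Phi> (t *\<^sub>R z) * indicator {0<..} t \<partial>lborel)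
        * indicator (ball 0 1) z \<partial>lborel)
      = (\<integral>\<^sup>+z. (\<integral>\<^sup>+t. ennreal (norm z) * \<Phi> (t *\<^sub>R z) * indicator {0<..} t
        * indicator (ball 0 1) z \<partial>lborel) \<partial>lborel)"
    by (intro nn_integral_cong nn_integral_multc[symmetric]) measurable
  also have "\<dots> = (\<integral>\<^sup>+t. (\<integral>\<^sup>+z. ennreal (norm z) * \<Phi> (t *\<^sub>R z) * indicator {0<..} t
        * indicator (ball 0 1) z \<partial>lborel) \<partial>lborel)"
    by (rule lborel_pair.Fubini'[symmetric]) (simp only: split_beta', measurable)
  also have "\<dots> = (\<integral>\<^sup>+t. (\<integral>\<^sup>+y. ?K t y \<partial>lborel) \<partial>lborel)"
    by (simp only: scale)
  also have "\<dots> = (\<integral>\<^sup>+y. (\<integral>\<^sup>+t. ?K t y \<partial>lborel) \<partial>lborel)"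
    by (rule lborel_pair.Fubini') (simp only: split_beta', measurable)
  also have "\<dots> = ennreal (1 / ?n) * (\<integral>\<^sup>+y. ennreal (norm y powr (1 - ?n)) * \<Phi> y \<partial>lborel)"
    by (simp only: inner) (rule nn_integral_cmult, measurable)
  finally show ?thesis
    by (simp add: mult.assoc[symmetric] ennreal_mult'[symmetric])
qed

text \<open>For a radial integrand the substitution \<open>r = norm z * t\<close> makes every ray
  \<open>z \<noteq> 0\<close> contribute the same amount, so \<open>nn_integral_rays\<close> leaves
  only the volume of the unit ball as the integral over directions.\<close>

lemma nn_integral_radial:
  fixes \<phi> :: "real \<Rightarrow> ennreal"
  assumes [measurable]: "\<phi> \<in> borel_measurable borel"
  shows "(\<integral>\<^sup>+y. ennreal (norm (y::'a::euclidean_space) powr (1 - real DIM('a))) * \<phi> (norm y) \<partial>lborel) =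
    ennreal (real DIM('a) * unit_ball_vol (real DIM('a))) * (\<integral>\<^sup>+r. \<phi> r * indicator {0<..} r \<partial>lborel)"
proof -
  have half_line: "(\<lambda>r. \<phi> r * indicator {0<..} r) \<in> borel_measurable borel"
    by measurable
  have scaled: "(\<lambda>t. \<phi> (0 + c * t) * indicator {0<..} (0 + c * t)) \<in> borel_measurable lborel" for c
    by measurable
  have ray: "(\<integral>\<^sup>+t. ennreal (norm z) * \<phi> (norm (t *\<^sub>R z)) * indicator {0<..} t \<partial>lborel)
      = (\<integral>\<^sup>+r. \<phi> r * indicator {0<..} r \<partial>lborel)" if "z \<noteq> 0" for z :: 'a
  proof -
    have "(\<integral>\<^sup>+r. \<phi> r * indicator {0<..} r \<partial>lborel)
        = ennreal \<bar>norm z\<bar> * (\<integral>\<^sup>+t. \<phi> (0 + norm z * t) * indicator {0<..} (0 + norm z * t) \<partial>lborel)"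
      using that by (intro nn_integral_real_affine[OF half_line]) simp
    also have "\<dots> = (\<integral>\<^sup>+t. ennreal (norm z) * (\<phi> (0 + norm z * t) * indicator {0<..} (0 + norm z * t)) \<partial>lborel)"
      by (simp only: nn_integral_cmult[OF scaled] abs_norm_cancel)
    also have "\<dots> = (\<integral>\<^sup>+t. ennreal (norm z) * \<phi> (norm (t *\<^sub>R z)) * indicator {0<..} t \<partial>lborel)"
      using that by (intro nn_integral_cong) (auto simp: indicator_def zero_less_mult_iff mult_ac)
    finally show ?thesis ..
  qed
  have "(\<integral>\<^sup>+y. ennreal (norm (y::'a) powr (1 - real DIM('a))) * \<phi> (norm y) \<partial>lborel)
      = ennreal (real DIM('a)) * (\<integral>\<^sup>+z. (\<integral>\<^sup>+t. ennreal (norm z) * \<phi> (norm (t *\<^sub>R z)) * indicator {0<..} t \<partial>lborel)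
        * indicator (ball 0 1) (z::'a) \<partial>lborel)"
    by (rule nn_integral_rays[of "\<lambda>y. \<phi> (norm y)"]) measurable
  also have "(\<integral>\<^sup>+z. (\<integral>\<^sup>+t. ennreal (norm z) * \<phi> (norm (t *\<^sub>R z)) * indicator {0<..} t \<partial>lborel)
        * indicator (ball 0 1) (z::'a) \<partial>lborel)
      = (\<integral>\<^sup>+z. (\<integral>\<^sup>+r. \<phi> r * indicator {0<..} r \<partial>lborel) * indicator (ball 0 1) (z::'a) \<partial>lborel)"
    by (rule nn_integral_cong_AE, rule eventually_mono[OF AE_lborel_singleton[of 0]])
       (simp add: ray del: norm_scaleR)
  also have "\<dots> = (\<integral>\<^sup>+r. \<phi> r * indicator {0<..} r \<partial>lborel) * ennreal (unit_ball_vol (real DIM('a)))"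
    by (simp add: nn_integral_cmult_indicator emeasure_ball)
  finally show ?thesis by (simp add: ennreal_mult'' mult_ac)
qed

text \<open>Integrated Young inequality. The reals \<open>a\<close> and \<open>b\<close> are
  positive upper bounds for the power integrals, not their exact values, so no separate case of a
  zero or infinite norm arises.\<close>

lemma nn_integral_Holder:
  fixes u v :: "'a \<Rightarrow> real"
  assumes [measurable]: "u \<in> borel_measurable M" "v \<in> borel_measurable M"
    and nonneg: "\<And>x. 0 \<le> u x" "\<And>x. 0 \<le> v x"
    and pq: "1 < p" "1 < q" "1 / p + 1 / q = 1" and ab: "0 < a" "0 < b"
    and u: "(\<integral>\<^sup>+x. ennreal (u x powr p) \<partial>M) \<le> ennreal a"
    and v: "(\<integral>\<^sup>+x. ennreal (v x powr q) \<partial>M) \<le> ennreal b"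
  shows "(\<integral>\<^sup>+x. ennreal (u x * v x) \<partial>M) \<le> ennreal (a powr (1 / p) * b powr (1 / q))"
proof -
  define A where "A = a powr (1 / p)"
  define B where "B = b powr (1 / q)"
  have AB: "0 < A" "0 < B" "A powr p = a" "B powr q = b"
    using ab pq by (auto simp: A_def B_def powr_powr)
  \<comment> \<open>Young's inequality for \<open>u x / A\<close> and \<open>v x / B\<close>; with
    this normalisation the integrated terms add up to
    \<open>A * B * (1 / p + 1 / q)\<close>.\<close>
  have young: "u x * v x \<le> A * B / (p * a) * (u x powr p) + A * B / (q * b) * (v x powr q)" for x
  proof -
    have "(u x / A) * (v x / B) \<le> (u x / A) powr p / p + (v x / B) powr q / q"
      using AB pq nonneg by (intro Youngs_inequality) auto
    also have "\<dots> = u x powr p / (p * a) + v x powr q / (q * b)"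
      using AB nonneg by (simp add: powr_divide mult.commute)
    finally have "A * B * ((u x / A) * (v x / B)) \<le> A * B * (u x powr p / (p * a) + v x powr q / (q * b))"
      using AB by (intro mult_left_mono) auto
    then show ?thesis using AB by (simp add: field_simps)
  qed
  have pos: "0 \<le> A * B / (p * a)" "0 \<le> A * B / (q * b)" using AB ab pq by auto
  have "(\<integral>\<^sup>+x. ennreal (u x * v x) \<partial>M)
      \<le> (\<integral>\<^sup>+x. ennreal (A * B / (p * a)) * ennreal (u x powr p) + ennreal (A * B / (q * b)) * ennreal (v x powr q) \<partial>M)"
  proof (rule nn_integral_mono)
    fix x
    have "ennreal (u x * v x) \<le> ennreal (A * B / (p * a) * (u x powr p) + A * B / (q * b) * (v x powr q))"
      by (rule ennreal_leI[OF young])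
    also have "\<dots> = ennreal (A * B / (p * a)) * ennreal (u x powr p) + ennreal (A * B / (q * b)) * ennreal (v x powr q)"
      using pos by (simp only: ennreal_plus ennreal_mult' powr_ge_zero mult_nonneg_nonneg)
    finally show "ennreal (u x * v x) \<le> \<dots>" .
  qed
  also have "\<dots> = ennreal (A * B / (p * a)) * (\<integral>\<^sup>+x. ennreal (u x powr p) \<partial>M)
      + ennreal (A * B / (q * b)) * (\<integral>\<^sup>+x. ennreal (v x powr q) \<partial>M)"
    by (simp add: nn_integral_add nn_integral_cmult)
  also have "\<dots> \<le> ennreal (A * B / (p * a)) * ennreal a + ennreal (A * B / (q * b)) * ennreal b"
    using u v by (intro add_mono mult_left_mono) auto
  also have "\<dots> = ennreal (A * B / (p * a) * a + A * B / (q * b) * b)"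
    using pos ab by (simp only: ennreal_plus ennreal_mult' mult_nonneg_nonneg less_imp_le)
  also have "A * B / (p * a) * a + A * B / (q * b) * b = A * B * (1 / p + 1 / q)"
    using ab by (simp add: field_simps)
  finally show ?thesis using pq by (simp add: A_def B_def)
qed

section \<open>The potential estimate\<close>

text \<open>Fundamental theorem of calculus along the ray from \<open>x\<close>, for
  \<open>f\<close> times a cut-off that falls linearly from 1 at \<open>x\<close> to 0 at distance
  \<open>\<rho>\<close>; the slope of the cut-off costs the term
  \<open>\<bar>f\<bar> / \<rho>\<close>. The direction \<open>z\<close> is not normalised, so that
  the right-hand side is an inner integral of \<open>nn_integral_rays\<close>.\<close>

lemma ray_bound:
  fixes f :: "'a::euclidean_space \<Rightarrow> real" and F :: "'a \<Rightarrow> 'a"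
  assumes deriv: "\<And>x. (f has_derivative (\<lambda>h. F x \<bullet> h)) (at x)"
    and cont: "continuous_on UNIV F" and "0 < \<rho>" and "z \<noteq> 0"
  shows "ennreal \<bar>f x\<bar> \<le> (\<integral>\<^sup>+t. ennreal (norm z) *
    (ennreal (norm (F (x + t *\<^sub>R z)) + \<bar>f (x + t *\<^sub>R z)\<bar> / \<rho>) * indicator (ball 0 \<rho>) (t *\<^sub>R z)) *
      indicator {0<..} t \<partial>lborel)"
proof -
  define b where "b = \<rho> / norm z"
  have b: "0 < b" "b * norm z = \<rho>" using assms by (auto simp: b_def)
  define c where "c = norm z / \<rho>"
  define h where "h t = f (x + t *\<^sub>R z) * (1 - t * c)" for t
  define h' where "h' t = (F (x + t *\<^sub>R z) \<bullet> z) * (1 - t * c) - f (x + t *\<^sub>R z) * c" for t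
  define k where "k t = norm z * (norm (F (x + t *\<^sub>R z)) + \<bar>f (x + t *\<^sub>R z)\<bar> / \<rho>)" for t
  have contf: "continuous_on UNIV f"
    using deriv by (meson continuous_at_imp_continuous_on has_derivative_continuous)
  have contf': "continuous_on {0..b} (\<lambda>t. f (x + t *\<^sub>R z))"
    by (rule continuous_on_compose2[OF contf]) (auto intro!: continuous_intros)
  have contF': "continuous_on {0..b} (\<lambda>t. F (x + t *\<^sub>R z))"
    by (rule continuous_on_compose2[OF cont]) (auto intro!: continuous_intros)
  have "(h has_vector_derivative h' t) (at t within {0..b})" for t
  proof -
    have "((\<lambda>t. f (x + t *\<^sub>R z)) has_derivative (\<lambda>s. F (x + t *\<^sub>R z) \<bullet> (s *\<^sub>R z))) (at t)"
      by (rule has_derivative_compose[of "\<lambda>t. x + t *\<^sub>R z" "\<lambda>s. s *\<^sub>R z" t UNIV f, OF _ deriv])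
         (auto intro!: derivative_eq_intros)
    then have "((\<lambda>t. f (x + t *\<^sub>R z)) has_real_derivative (F (x + t *\<^sub>R z) \<bullet> z)) (at t)"
      by (simp add: has_field_derivative_def mult_commute_abs)
    then have "(h has_real_derivative h' t) (at t)"
      unfolding h_def h'_def by (auto intro!: derivative_eq_intros simp: algebra_simps)
    then show ?thesis
      using has_field_derivative_at_within has_real_derivative_iff_has_vector_derivative by blast
  qed
  then have hint: "(h' has_integral (h b - h 0)) {0..b}"
    using b by (intro fundamental_theorem_of_calculus) auto
  have kint: "k integrable_on {0..b}"
    unfolding k_def using \<open>0 < \<rho>\<close> by (intro integrable_continuous_real continuous_intros contf' contF') auto
  have le: "norm (h' t) \<le> k t" if "t \<in> {0..b}" for t
  proof -
    have "t * norm z \<le> \<rho>" using that b by (metis atLeastAtMost_iff mult_right_mono norm_ge_zero)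
    then have "0 \<le> 1 - t * c" "1 - t * c \<le> 1" using that \<open>0 < \<rho>\<close> by (auto simp: c_def)
    then have "\<bar>(F (x + t *\<^sub>R z) \<bullet> z) * (1 - t * c)\<bar> \<le> norm (F (x + t *\<^sub>R z)) * norm z * 1"
      unfolding abs_mult by (intro mult_mono Cauchy_Schwarz_ineq2) auto
    moreover have "\<bar>f (x + t *\<^sub>R z) * c\<bar> = \<bar>f (x + t *\<^sub>R z)\<bar> / \<rho> * norm z"
      using \<open>0 < \<rho>\<close> by (simp add: abs_mult c_def)
    ultimately have "norm (h' t) \<le> norm (F (x + t *\<^sub>R z)) * norm z * 1 + \<bar>f (x + t *\<^sub>R z)\<bar> / \<rho> * norm z"
      unfolding h'_def real_norm_def using abs_triangle_ineq4 by (smt (verit))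
    then show ?thesis unfolding k_def by (simp add: algebra_simps)
  qed
  have "h b = 0" "h 0 = f x" using b \<open>0 < \<rho>\<close> by (auto simp: h_def c_def)
  then have "integral {0..b} h' = - f x" using integral_unique[OF hint] by simp
  then have "\<bar>f x\<bar> \<le> integral {0..b} k"
    using integral_norm_bound_integral[of h' "{0..b}" k] hint kint le by (auto simp: has_integral_integrable)
  then have "ennreal \<bar>f x\<bar> \<le> ennreal (integral {0..b} k)" by (rule ennreal_leI)
  also have "\<dots> = (\<integral>\<^sup>+t. ennreal (k t) * indicator {0..b} t \<partial>lborel)"
    using \<open>0 < \<rho>\<close>
    by (intro nn_integral_has_integral_lebesgue'[symmetric] integrable_integral kint) (simp add: k_def)
  also have "\<dots> \<le> (\<integral>\<^sup>+t. ennreal (norm z) *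
    (ennreal (norm (F (x + t *\<^sub>R z)) + \<bar>f (x + t *\<^sub>R z)\<bar> / \<rho>) * indicator (ball 0 \<rho>) (t *\<^sub>R z)) *
      indicator {0<..} t \<partial>lborel)"
  \<comment> \<open>The endpoints \<open>0\<close> and \<open>b\<close> are discarded as null sets,
    since the right-hand side sees only positive \<open>t\<close> and the open ball.\<close>
  proof (rule nn_integral_mono_AE, rule eventually_mono[OF eventually_conj[OF AE_lborel_singleton[of 0] AE_lborel_singleton[of b]]])
    fix t assume t: "t \<noteq> 0 \<and> t \<noteq> b"
    show "ennreal (k t) * indicator {0..b} t \<le> ennreal (norm z) *
      (ennreal (norm (F (x + t *\<^sub>R z)) + \<bar>f (x + t *\<^sub>R z)\<bar> / \<rho>) * indicator (ball 0 \<rho>) (t *\<^sub>R z)) *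
      indicator {0<..} t"
    proof (cases "t \<in> {0..b}")
      case True
      with t have "0 < t" "t * norm z < \<rho>"
        using b \<open>z \<noteq> 0\<close> by (auto simp flip: b(2))
      then show ?thesis
        unfolding k_def using True by (simp add: ennreal_mult')
    qed simp
  qed
  finally show ?thesis .
qed

text \<open>Integrating \<open>ray_bound\<close> over all \<open>z\<close> in the unit ball turns
  the left-hand side into the volume of the ball times \<open>\<bar>f x\<bar>\<close>, and
  \<open>nn_integral_rays\<close> turns the right-hand side into a potential with kernel
  \<open>norm y powr (1 - N)\<close>, \<open>N = DIM('a)\<close>. The constant on the left is the
  area of the unit sphere; this is how \<open>alpha_N\<close> enters.\<close>

lemma potential_bound:
  fixes f :: "'a::euclidean_space \<Rightarrow> real" and F :: "'a \<Rightarrow> 'a"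
  assumes deriv: "\<And>x. (f has_derivative (\<lambda>h. F x \<bullet> h)) (at x)"
    and cont: "continuous_on UNIV F" and "0 < \<rho>"
  shows "ennreal (real DIM('a) * unit_ball_vol (real DIM('a)) * \<bar>f x\<bar>) \<le>
    (\<integral>\<^sup>+y. ennreal (norm y powr (1 - real DIM('a))) *
      (ennreal (norm (F (x + y)) + \<bar>f (x + y)\<bar> / \<rho>) * indicator (ball 0 \<rho>) y) \<partial>lborel)"
proof -
  have contf: "continuous_on UNIV f"
    using deriv by (meson continuous_at_imp_continuous_on has_derivative_continuous)
  have [measurable]: "f \<in> borel_measurable borel" "F \<in> borel_measurable borel"
    using contf cont by (auto intro: borel_measurable_continuous_onI)
  have [measurable]: "ball (0::'a) \<rho> \<in> sets borel" by simp
  let ?\<Phi> = "\<lambda>y. ennreal (norm (F (x + y)) + \<bar>f (x + y)\<bar> / \<rho>) * indicator (ball 0 \<rho>) y"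
  have "ennreal (real DIM('a) * unit_ball_vol (real DIM('a)) * \<bar>f x\<bar>)
      = ennreal (real DIM('a)) * (\<integral>\<^sup>+z. ennreal \<bar>f x\<bar> * indicator (ball 0 1) (z::'a) \<partial>lborel)"
    by (simp add: nn_integral_cmult_indicator emeasure_ball ennreal_mult' mult_ac)
  also have "\<dots> \<le> ennreal (real DIM('a)) * (\<integral>\<^sup>+z. (\<integral>\<^sup>+t. ennreal (norm z) * ?\<Phi> (t *\<^sub>R z) *
      indicator {0<..} t \<partial>lborel) * indicator (ball 0 1) z \<partial>lborel)"
  proof (rule mult_left_mono[OF nn_integral_mono_AE[OF eventually_mono[OF AE_lborel_singleton[of 0]]]])
    fix z :: 'a assume "z \<noteq> 0"
    from ray_bound[OF deriv cont \<open>0 < \<rho>\<close> this]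
    show "ennreal \<bar>f x\<bar> * indicator (ball 0 1) z \<le>
      (\<integral>\<^sup>+t. ennreal (norm z) * ?\<Phi> (t *\<^sub>R z) * indicator {0<..} t \<partial>lborel) * indicator (ball 0 1) z"
      by (rule mult_right_mono) simp
  qed simp
  also have "\<dots> = (\<integral>\<^sup>+y. ennreal (norm y powr (1 - real DIM('a))) * ?\<Phi> y \<partial>lborel)"
    by (rule nn_integral_rays[symmetric]) measurable
  finally show ?thesis .
qed

section \<open>Test functions as differentiable functions, and the area of the sphere\<close>

lemma test_function_has_derivative:
  fixes f :: "real ^ 'n::finite \<Rightarrow> real"
  assumes "test_function f"
  shows "(f has_derivative (\<lambda>h. grad f x \<bullet> h)) (at x)"
proof -
  have "Ck 1 f" using assms unfolding test_function_def by blast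
  then have "f differentiable (at x)" by simp
  then have D: "(f has_derivative frechet_derivative f (at x)) (at x)"
    by (simp add: frechet_derivative_works)
  then interpret linear "frechet_derivative f (at x)"
    using has_derivative_linear by blast
  have "frechet_derivative f (at x) h = grad f x \<bullet> h" for h
  proof -
    have "frechet_derivative f (at x) h = frechet_derivative f (at x) (\<Sum>i\<in>UNIV. h $ i *\<^sub>R axis i 1)"
      using basis_expansion[of h] by (simp add: scalar_mult_eq_scaleR)
    also have "\<dots> = grad f x \<bullet> h"
      by (simp add: sum scale grad_def partial_deriv_def inner_vec_def mult.commute)
    finally show ?thesis .
  qed
  then have "frechet_derivative f (at x) = (\<lambda>h. grad f x \<bullet> h)" by auto
  with D show ?thesis by simp
qed

lemma test_function_continuous_grad:
  assumes "test_function f"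
  shows "continuous_on UNIV (grad f)"
proof -
  have "Ck 1 f" using assms unfolding test_function_def by blast
  then have "continuous_on UNIV (partial_deriv i f)" for i by simp
  then show ?thesis unfolding grad_def by (intro continuous_on_vec_lambda)
qed

lemma test_function_continuous:
  assumes "test_function f"
  shows "continuous_on UNIV f"
  using assms unfolding test_function_def by (metis Ck.simps(1))

lemma test_function_measurable:
  assumes "test_function f"
  shows "f \<in> borel_measurable borel" "grad f \<in> borel_measurable borel"
  using test_function_continuous[OF assms] test_function_continuous_grad[OF assms]
  by (auto intro: borel_measurable_continuous_onI)

text \<open>The cone over the unit sphere is the punctured unit ball, and removing the centre does
  not change the volume.\<close>

lemma sphere_area_eq:
  "sphere_area TYPE('n::finite) = real CARD('n) * unit_ball_vol (real CARD('n))"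
proof -
  have "{t *\<^sub>R x | t x. 0 < t \<and> t < 1 \<and> x \<in> sphere (0 :: real ^ 'n) 1} = ball 0 1 - {0}"
  proof (intro equalityI subsetI)
    fix y :: "real ^ 'n" assume y: "y \<in> ball 0 1 - {0}"
    then have "y = norm y *\<^sub>R (y /\<^sub>R norm y)" "0 < norm y" "norm y < 1" "y /\<^sub>R norm y \<in> sphere 0 1"
      by auto
    then show "y \<in> {t *\<^sub>R x | t x. 0 < t \<and> t < 1 \<and> x \<in> sphere (0 :: real ^ 'n) 1}" by blast
  qed auto
  moreover have "measure lebesgue (ball (0 :: real ^ 'n) 1 - {0}) = measure lebesgue (ball (0 :: real ^ 'n) 1)"
    by (intro measure_Diff_null_set) auto
  ultimately show ?thesis
    by (simp add: sphere_area_def sphere_surface_measure_def content_ball)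
qed

section \<open>Explicit integrals of two radial kernels over a ball\<close>

lemma nn_integral_FTC_interior:
  fixes G k :: "real \<Rightarrow> real"
  assumes "a \<le> b" and G: "\<And>r. a < r \<Longrightarrow> r < b \<Longrightarrow> (G has_real_derivative k r) (at r)"
    and "continuous_on {a..b} G" and "\<And>r. r \<in> {a..b} \<Longrightarrow> 0 \<le> k r"
  shows "(\<integral>\<^sup>+r. ennreal (k r) * indicator {a..b} r \<partial>lborel) = ennreal (G b - G a)"
  using assms
  by (intro nn_integral_has_integral_lebesgue' fundamental_theorem_of_calculus_interior)
     (auto simp flip: has_real_derivative_iff_has_vector_derivative)

text \<open>In polar coordinates the kernel becomes
  \<open>r powr (a - 1) / (r powr a + l * \<rho> powr a)\<close>, with antiderivative
  \<open>ln (r powr a + l * \<rho> powr a) / a\<close>. The result does not depend on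
  \<open>\<rho>\<close> and grows like a logarithm as \<open>l\<close> tends to 0; exponentiating
  this logarithm is what later produces an exponential bound.\<close>

lemma nn_integral_log_kernel:
  fixes a l \<rho> :: real
  defines "n \<equiv> real DIM('a::euclidean_space)"
  assumes "0 < a" "0 < l" "0 < \<rho>"
  shows "(\<integral>\<^sup>+y. ennreal (norm (y::'a) powr - n / (1 + l * (norm y / \<rho>) powr - a)) * indicator (ball 0 \<rho>) y \<partial>lborel)
    = ennreal (n * unit_ball_vol n / a * ln ((1 + l) / l))"
proof -
  define k where "k r = r powr - 1 / (1 + l * (r / \<rho>) powr - a)" for r
  have k_meas [measurable]: "k \<in> borel_measurable borel" unfolding k_def by measurable
  have "(\<integral>\<^sup>+y. ennreal (norm (y::'a) powr - n / (1 + l * (norm y / \<rho>) powr - a)) * indicator (ball 0 \<rho>) y \<partial>lborel)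
      = (\<integral>\<^sup>+y. ennreal (norm (y::'a) powr (1 - n)) * (ennreal (k (norm y)) * indicator {..<\<rho>} (norm y)) \<partial>lborel)"
  proof (intro nn_integral_cong)
    fix y :: 'a
    have "norm y powr - n = norm y powr (1 - n) * norm y powr - 1" by (subst powr_add[symmetric]) simp
    then have "norm y powr - n / (1 + l * (norm y / \<rho>) powr - a) = norm y powr (1 - n) * k (norm y)"
      by (simp add: k_def)
    then show "ennreal (norm y powr - n / (1 + l * (norm y / \<rho>) powr - a)) * indicator (ball 0 \<rho>) y
      = ennreal (norm y powr (1 - n)) * (ennreal (k (norm y)) * indicator {..<\<rho>} (norm y))"
      by (auto simp: indicator_def ennreal_mult')
  qed
  also have "\<dots> = ennreal (n * unit_ball_vol n) *
      (\<integral>\<^sup>+r. (ennreal (k r) * indicator {..<\<rho>} r) * indicator {0<..} r \<partial>lborel)"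
    unfolding n_def by (rule nn_integral_radial) measurable
  also have "(\<integral>\<^sup>+r. (ennreal (k r) * indicator {..<\<rho>} r) * indicator {0<..} r \<partial>lborel)
      = (\<integral>\<^sup>+r. ennreal (k r) * indicator {0..\<rho>} r \<partial>lborel)"
    by (rule nn_integral_cong_AE, rule eventually_mono[OF eventually_conj[OF AE_lborel_singleton[of 0] AE_lborel_singleton[of \<rho>]]])
       (auto simp: indicator_def)
  \<comment> \<open>The lower boundary value is finite because \<open>l * \<rho> powr a\<close>
    keeps the argument of the logarithm positive at \<open>r = 0\<close>. Since
    \<open>r powr a\<close> may fail to be differentiable there, only interior derivatives are
    used.\<close>
  also have "\<dots> = ennreal (ln (\<rho> powr a + l * \<rho> powr a) / a - ln (0 powr a + l * \<rho> powr a) / a)"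
  proof (rule nn_integral_FTC_interior)
    fix r :: real assume "0 < r" "r < \<rho>"
    then have pos: "0 < r powr a + l * \<rho> powr a" using assms by (simp add: add_pos_pos)
    have "((\<lambda>r. ln (r powr a + l * \<rho> powr a) / a) has_real_derivative
        (a * r powr (a - 1)) / (r powr a + l * \<rho> powr a) / a) (at r)"
      using pos \<open>0 < r\<close> \<open>0 < a\<close> by (auto intro!: derivative_eq_intros)
    also have "(a * r powr (a - 1)) / (r powr a + l * \<rho> powr a) / a = k r"
    proof -
      have "(r / \<rho>) powr - a = \<rho> powr a / r powr a"
        using \<open>0 < r\<close> \<open>0 < \<rho>\<close> by (simp add: powr_divide powr_minus field_simps)
      then have k: "k r = (1 / r) / (1 + l * (\<rho> powr a / r powr a))"
        using \<open>0 < r\<close> by (simp only: k_def powr_minus_divide) simp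
      have "0 < r powr a" "r powr (a - 1) = r powr a / r" using \<open>0 < r\<close> by (auto simp: powr_diff)
      then show ?thesis unfolding k
        using pos \<open>0 < r\<close> \<open>0 < a\<close> by (simp add: divide_simps)
    qed
    finally show "((\<lambda>r. ln (r powr a + l * \<rho> powr a) / a) has_real_derivative k r) (at r)" .
  next
    have "0 < r powr a + l * \<rho> powr a" for r
      using assms by (simp add: add_nonneg_pos)
    then show "continuous_on {0..\<rho>} (\<lambda>r. ln (r powr a + l * \<rho> powr a) / a)"
      using assms
      by (intro continuous_intros continuous_on_powr') (auto simp: less_imp_neq[symmetric])
    show "0 \<le> k r" for r using \<open>0 < l\<close> by (simp add: k_def)
  qed (use assms in auto)
  also have "ln (\<rho> powr a + l * \<rho> powr a) / a - ln (0 powr a + l * \<rho> powr a) / a = ln ((1 + l) / l) / a"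
  proof -
    have "ln (\<rho> powr a + l * \<rho> powr a) - ln (l * \<rho> powr a) = ln ((1 + l) / l)"
      using assms by (subst ln_divide_pos[symmetric]) (auto simp: field_simps add_pos_pos)
    then show ?thesis by (simp flip: diff_divide_distrib)
  qed
  finally show ?thesis
    by (simp add: ennreal_mult'[symmetric] n_def)
qed

text \<open>The singularity is integrable because \<open>s < n\<close>, and scaling leaves exactly
  the factor \<open>\<rho> powr n\<close>, which later cancels the logarithmic weight.\<close>

lemma nn_integral_power_kernel:
  fixes s \<rho> :: real
  defines "n \<equiv> real DIM('a::euclidean_space)"
  assumes "s < n" "0 < \<rho>"
  shows "(\<integral>\<^sup>+y. ennreal ((norm (y::'a) / \<rho>) powr - s) * indicator (ball 0 \<rho>) y \<partial>lborel)
    = ennreal (n * unit_ball_vol n / (n - s) * \<rho> powr n)"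
proof -
  define k where "k r = r powr (n - 1) * (r / \<rho>) powr - s" for r
  have k_meas [measurable]: "k \<in> borel_measurable borel" unfolding k_def by measurable
  have "(\<integral>\<^sup>+y. ennreal ((norm (y::'a) / \<rho>) powr - s) * indicator (ball 0 \<rho>) y \<partial>lborel)
      = (\<integral>\<^sup>+y. ennreal (norm (y::'a) powr (1 - n)) * (ennreal (k (norm y)) * indicator {..<\<rho>} (norm y)) \<partial>lborel)"
  proof (intro nn_integral_cong)
    fix y :: 'a
    \<comment> \<open>At the origin the product is 0 by \<open>0 powr r = 0\<close>; the identity
      derived from it survives because \<open>(norm y / \<rho>) powr - s\<close> is 0 there as
      well.\<close>
    have "norm y powr (1 - n) * norm y powr (n - 1) = (if y = 0 then 0 else 1)" by (simp flip: powr_add)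
    then have "(norm y / \<rho>) powr - s = norm y powr (1 - n) * k (norm y)"
      by (simp add: k_def split: if_splits flip: mult.assoc)
    then show "ennreal ((norm y / \<rho>) powr - s) * indicator (ball 0 \<rho>) y
      = ennreal (norm y powr (1 - n)) * (ennreal (k (norm y)) * indicator {..<\<rho>} (norm y))"
      by (auto simp: indicator_def ennreal_mult')
  qed
  also have "\<dots> = ennreal (n * unit_ball_vol n) *
      (\<integral>\<^sup>+r. (ennreal (k r) * indicator {..<\<rho>} r) * indicator {0<..} r \<partial>lborel)"
    unfolding n_def by (rule nn_integral_radial) measurable
  also have "(\<integral>\<^sup>+r. (ennreal (k r) * indicator {..<\<rho>} r) * indicator {0<..} r \<partial>lborel)
      = (\<integral>\<^sup>+r. ennreal (k r) * indicator {0..\<rho>} r \<partial>lborel)"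
    by (rule nn_integral_cong_AE, rule eventually_mono[OF eventually_conj[OF AE_lborel_singleton[of 0] AE_lborel_singleton[of \<rho>]]])
       (auto simp: indicator_def)
  also have "\<dots> = ennreal (\<rho> powr s * \<rho> powr (n - s) / (n - s) - \<rho> powr s * 0 powr (n - s) / (n - s))"
  proof (rule nn_integral_FTC_interior)
    fix r :: real assume "0 < r" "r < \<rho>"
    have "((\<lambda>r. \<rho> powr s * r powr (n - s) / (n - s)) has_real_derivative
        \<rho> powr s * ((n - s) * r powr (n - s - 1)) / (n - s)) (at r)"
      using \<open>0 < r\<close> by (auto intro!: derivative_eq_intros)
    also have "\<rho> powr s * ((n - s) * r powr (n - s - 1)) / (n - s) = k r"
      unfolding k_def using \<open>0 < r\<close> \<open>0 < \<rho>\<close> \<open>s < n\<close>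
      by (simp add: powr_divide powr_diff powr_minus powr_add field_simps)
    finally show "((\<lambda>r. \<rho> powr s * r powr (n - s) / (n - s)) has_real_derivative k r) (at r)" .
  next
    show "continuous_on {0..\<rho>} (\<lambda>r. \<rho> powr s * r powr (n - s) / (n - s))"
      using assms by (intro continuous_intros continuous_on_powr') auto
    show "0 \<le> k r" for r by (simp add: k_def)
  qed (use assms in auto)
  also have "\<rho> powr s * \<rho> powr (n - s) / (n - s) - \<rho> powr s * 0 powr (n - s) / (n - s) = \<rho> powr n / (n - s)"
    by (simp flip: powr_add)
  finally show ?thesis
    by (simp add: ennreal_mult'[symmetric] n_def)
qed

section \<open>The exponential estimate\<close>

text \<open>The potential is split by Hoelder with the weight \<open>H\<close>. The first factor is
  controlled by the energy plus a power of \<open>l\<close> times the potential \<open>?g\<close>,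
  the second is essentially \<open>ln (1 / l)\<close>. Letting \<open>l\<close> decay like
  \<open>?g\<close> to the power \<open>- 1 / (n - 1)\<close> keeps the first factor bounded and
  makes the exponent about \<open>ln ?g\<close>, so its exponential is about \<open>?g\<close>. Of
  the spare factor \<open>(1 + \<epsilon>) ^ 4\<close> in the hypothesis on \<open>\<beta>\<close>,
  three powers pay for the first Hoelder factor and one for \<open>a\<close>.\<close>

lemma exp_potential_bound:
  fixes f :: "'a::euclidean_space \<Rightarrow> real" and F :: "'a \<Rightarrow> 'a" and e :: "'a \<Rightarrow> real"
  defines "n \<equiv> real DIM('a)"
  assumes deriv: "\<And>x. (f has_derivative (\<lambda>h. F x \<bullet> h)) (at x)"
    and cont: "continuous_on UNIV F" and "0 < \<rho>" and dim: "2 \<le> DIM('a)"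
    and e_meas [measurable]: "e \<in> borel_measurable borel" and e_nonneg: "\<And>y. 0 \<le> e y"
    and \<epsilon>: "0 < \<epsilon>" "\<epsilon> \<le> 1"
    and le_e: "\<And>y. norm y < \<rho> \<Longrightarrow>
      (norm (F (x + y)) + \<bar>f (x + y)\<bar> / \<rho>) ^ DIM('a) \<le> (1 + \<epsilon>) ^ (DIM('a) - 1) * e (x + y)"
    and e_int: "(\<integral>\<^sup>+y. ennreal (e y) \<partial>lborel) \<le> ennreal (1 + \<epsilon>)"
    and \<beta>: "0 < \<beta>" "\<beta> * (1 + \<epsilon>) ^ 4 \<le> n * (n * unit_ball_vol n) powr (1 / (n - 1))"
  shows "ennreal (exp (\<beta> * \<bar>f x\<bar> powr (n / (n - 1)))) \<le> ennreal ((2 / \<epsilon>) ^ (DIM('a) - 1)) *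
    max 1 (\<integral>\<^sup>+y. ennreal (e (x + y) * (norm y / \<rho>) powr - (n / (1 + \<epsilon>))) * indicator (ball 0 \<rho>) y \<partial>lborel)"
    (is "_ \<le> _ * max 1 ?g")
proof (cases ?g)
  case top
  then show ?thesis using \<epsilon> by (simp add: ennreal_mult_top)
next
  case (real \<gamma>)
  define M where "M = max 1 \<gamma>"
  obtain k where k: "DIM('a) = Suc (Suc k)" using dim by (metis add_2_eq_Suc le_Suc_ex)
  define m where "m = n - 1"
  have m: "1 \<le> m" "n = m + 1" "m = real (Suc k)" "n = real (Suc (Suc k))" "2 \<le> n"
    using k by (auto simp: m_def n_def)
  define V where "V = n * unit_ball_vol n"
  have V: "0 < V" using m by (simp add: V_def)
  have M: "1 \<le> M" "\<gamma> \<le> M" "max 1 ?g = ennreal M"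
    unfolding M_def using real by (auto simp: max_def ennreal_le_1 not_le)
  \<comment> \<open>This makes \<open>(l / \<epsilon>) ^ Suc k = 1 / M\<close>, so that the
    contribution of \<open>\<gamma>\<close> to the first Hoelder factor stays below
    \<open>\<epsilon>\<close>.\<close>
  define l where "l = \<epsilon> * M powr (- 1 / m)"
  have l: "0 < l" "l \<le> 1"
  proof -
    show "0 < l" using \<epsilon> M by (simp add: l_def)
    have "M powr (- 1 / m) \<le> M powr 0" using M m by (intro powr_mono) auto
    then show "l \<le> 1" unfolding l_def using \<epsilon> M by (simp add: mult_le_one)
  qed
  \<comment> \<open>The exponent is fixed by \<open>a * m = n / (1 + \<epsilon>)\<close>: the top
    power of \<open>q\<close> in \<open>H\<close> is then a kernel of order below \<open>n\<close>,
    whose integral converges.\<close>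
  define a where "a = n / (1 + \<epsilon>) / m"
  have a: "0 < a" "a * m = n / (1 + \<epsilon>)" using m \<epsilon> by (auto simp: a_def)
  define q where "q y = (norm y / \<rho>) powr - a" for y :: 'a
  define H where "H y = (1 + l * q y) ^ Suc k" for y
  have H: "1 \<le> H y" for y unfolding H_def by (rule one_le_power) (use l in \<open>simp add: q_def\<close>)
  define T where "T y = norm (F (x + y)) + \<bar>f (x + y)\<bar> / \<rho>" for y
  have T: "0 \<le> T y" for y using \<open>0 < \<rho>\<close> by (simp add: T_def)
  have contf: "continuous_on UNIV f"
    using deriv by (meson continuous_at_imp_continuous_on has_derivative_continuous)
  have [measurable]: "f \<in> borel_measurable borel" "F \<in> borel_measurable borel"
    using contf cont by (auto intro: borel_measurable_continuous_onI)
  have [measurable]: "T \<in> borel_measurable borel" unfolding T_def by measurable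
  have [measurable]: "H \<in> borel_measurable borel" unfolding H_def q_def by measurable
  have [measurable]: "ball (0::'a) \<rho> \<in> sets borel" by simp
  define u where "u y = T y * H y powr (1 / n) * indicator (ball 0 \<rho>) y" for y
  define v where "v y = norm y powr (1 - n) * H y powr (- 1 / n) * indicator (ball 0 \<rho>) y" for y
  \<comment> \<open>In \<open>A\<close>, the hypothesis \<open>le_e\<close> accounts for
    \<open>Suc k\<close> powers of \<open>1 + \<epsilon>\<close>, the splitting of \<open>H\<close>
    for \<open>k\<close>, and the total energy, at most \<open>1 + 2 * \<epsilon>\<close>, for two.
    \<open>B\<close> is the value of \<open>nn_integral_log_kernel\<close>.\<close>
  define A where "A = (1 + \<epsilon>) ^ (2 * Suc k + 1)"
  define B where "B = V / a * ln ((1 + l) / l)"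
  have A: "0 < A" using \<epsilon> by (simp add: A_def)
  have B: "0 < B" unfolding B_def using V a l by (auto intro!: mult_pos_pos ln_gt_zero)
  have u_le: "(\<integral>\<^sup>+y. ennreal (u y powr n) \<partial>lborel) \<le> ennreal A"
  proof -
    define c where "c = (1 + \<epsilon>) ^ (Suc k + k)"
    have c: "0 \<le> c" using \<epsilon> by (simp add: c_def)
    have pt: "ennreal (u y powr n) \<le> ennreal c * (ennreal (e (x + y)) +
        ennreal (\<epsilon> / M) * (ennreal (e (x + y) * (norm y / \<rho>) powr - (n / (1 + \<epsilon>))) * indicator (ball 0 \<rho>) y))" for y
    proof (cases "norm y < \<rho>")
      case True
      have "T y powr n = T y ^ Suc (Suc k)" unfolding m(4) using T[of y] by (intro powr_realpow') auto
      moreover have "(H y powr (1 / n)) powr n = H y" using H[of y] m(5) by (simp add: powr_powr)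
      ultimately have "u y powr n = T y ^ DIM('a) * H y"
        using True T[of y] by (simp add: u_def powr_mult k)
      also have "\<dots> \<le> ((1 + \<epsilon>) ^ Suc k * e (x + y)) * H y"
        using le_e[OF True] H[of y] by (intro mult_right_mono) (auto simp: T_def k)
      also have "\<dots> \<le> ((1 + \<epsilon>) ^ Suc k * e (x + y)) * ((1 + \<epsilon>) ^ k * (1 + \<epsilon> / M * (norm y / \<rho>) powr - (n / (1 + \<epsilon>))))"
      proof (rule mult_left_mono)
        \<comment> \<open>Convexity with \<open>h = \<epsilon>\<close> separates the constant part
          of the weight from its singular part, and the choice of \<open>l\<close> gives the latter
          the factor \<open>1 / M\<close>.\<close>
        have "H y \<le> (1 + \<epsilon>) ^ k * (1 + \<epsilon> * (l * q y / \<epsilon>) ^ Suc k)"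
          using convex_combination_power_le[of 1 "l * q y / \<epsilon>" \<epsilon> k] \<epsilon> l by (simp add: H_def q_def)
        also have "(l * q y / \<epsilon>) ^ Suc k = (norm y / \<rho>) powr - (n / (1 + \<epsilon>)) / M"
        proof -
          have "l * q y / \<epsilon> = M powr (- 1 / m) * q y" using \<epsilon> by (simp add: l_def)
          then have "(l * q y / \<epsilon>) ^ Suc k = (M powr (- 1 / m)) ^ Suc k * q y ^ Suc k"
            by (simp only: power_mult_distrib)
          also have "(M powr (- 1 / m)) ^ Suc k = M powr (- 1)"
            using M m by (subst powr_power) (auto simp: m(3))
          also have "q y ^ Suc k = (norm y / \<rho>) powr - (n / (1 + \<epsilon>))"
          proof (cases "norm y / \<rho> = 0")
            case False
            then have "q y ^ Suc k = (norm y / \<rho>) powr (- a * real (Suc k))"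
              unfolding q_def by (subst powr_power) (auto simp: mult.commute)
            then show ?thesis using a(2) m(3) by simp
          next
            case True
            then show ?thesis by (simp only: q_def) simp
          qed
          finally show ?thesis using M by (simp add: powr_minus field_simps)
        qed
        finally show "H y \<le> (1 + \<epsilon>) ^ k * (1 + \<epsilon> / M * (norm y / \<rho>) powr - (n / (1 + \<epsilon>)))" by simp
      qed (use \<epsilon> e_nonneg in auto)
      also have "\<dots> = c * (e (x + y) + \<epsilon> / M * (e (x + y) * (norm y / \<rho>) powr - (n / (1 + \<epsilon>))))"
        by (simp add: c_def power_add algebra_simps)
      finally have "ennreal (u y powr n) \<le> ennreal \<dots>" by (rule ennreal_leI)
      also have "\<dots> = ennreal c * (ennreal (e (x + y)) +
        ennreal (\<epsilon> / M) * (ennreal (e (x + y) * (norm y / \<rho>) powr - (n / (1 + \<epsilon>))) * indicator (ball 0 \<rho>) y))"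
      proof -
        have *: "ennreal (c * (E + d * K)) = ennreal c * (ennreal E + ennreal d * (ennreal K * 1))"
          if "0 \<le> E" "0 \<le> d" "0 \<le> K" for E d K
          using c that by (simp add: ennreal_mult')
        have **: "indicator (ball 0 \<rho>) y = (1 :: ennreal)" using True by simp
        show ?thesis unfolding ** by (rule *) (use e_nonneg \<epsilon> M in auto)
      qed
      finally show ?thesis .
    qed (simp add: u_def)
    have "(\<integral>\<^sup>+y. ennreal (u y powr n) \<partial>lborel) \<le> (\<integral>\<^sup>+y. ennreal c * (ennreal (e (x + y)) +
        ennreal (\<epsilon> / M) * (ennreal (e (x + y) * (norm y / \<rho>) powr - (n / (1 + \<epsilon>))) * indicator (ball 0 \<rho>) y)) \<partial>lborel)"
      by (intro nn_integral_mono pt)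
    also have "\<dots> = ennreal c * ((\<integral>\<^sup>+y. ennreal (e (x + y)) \<partial>lborel) + ennreal (\<epsilon> / M) * ?g)"
      by (simp add: nn_integral_cmult nn_integral_add)
    also have "(\<integral>\<^sup>+y. ennreal (e (x + y)) \<partial>lborel) = (\<integral>\<^sup>+y. ennreal (e y) \<partial>lborel)"
      by (rule nn_integral_lborel_translation[symmetric]) measurable
    also have "ennreal c * ((\<integral>\<^sup>+y. ennreal (e y) \<partial>lborel) + ennreal (\<epsilon> / M) * ?g)
        \<le> ennreal c * (ennreal (1 + \<epsilon>) + ennreal \<epsilon>)"
    proof (intro mult_left_mono add_mono e_int)
      have "\<epsilon> / M * \<gamma> \<le> \<epsilon>" using M \<epsilon> by (simp add: field_simps)
      then show "ennreal (\<epsilon> / M) * ?g \<le> ennreal \<epsilon>"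
        using real M \<epsilon> by (simp flip: ennreal_mult' add: ennreal_leI)
    qed auto
    also have "\<dots> = ennreal (c * (1 + 2 * \<epsilon>))"
    proof -
      have "ennreal (1 + \<epsilon>) + ennreal \<epsilon> = ennreal (1 + 2 * \<epsilon>)" using \<epsilon> by (simp flip: ennreal_plus)
      then show ?thesis using c by (simp only: ennreal_mult')
    qed
    also have "\<dots> \<le> ennreal A"
    proof (rule ennreal_leI)
      have "c * (1 + 2 * \<epsilon>) \<le> c * (1 + \<epsilon>) ^ 2"
        using c by (intro mult_left_mono) (auto simp: power2_eq_square algebra_simps)
      also have "\<dots> = A" unfolding A_def c_def power_add[symmetric] by (rule arg_cong[where f="\<lambda>i. (1 + \<epsilon>) ^ i"]) simp
      finally show "c * (1 + 2 * \<epsilon>) \<le> A" .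
    qed
    finally show ?thesis .
  qed
  have v_le: "(\<integral>\<^sup>+y. ennreal (v y powr (n / m)) \<partial>lborel) \<le> ennreal B"
  proof -
    \<comment> \<open>The conjugate exponent \<open>n / m\<close> turns the potential kernel into
      the critical \<open>norm y powr - n\<close> and \<open>H y powr (- 1 / n)\<close> into
      \<open>1 / (1 + l * q y)\<close>, which is the logarithmic kernel.\<close>
    have "(\<integral>\<^sup>+y. ennreal (v y powr (n / m)) \<partial>lborel)
        = (\<integral>\<^sup>+y. ennreal (norm (y::'a) powr - n / (1 + l * (norm y / \<rho>) powr - a)) * indicator (ball 0 \<rho>) y \<partial>lborel)"
    proof (intro nn_integral_cong)
      fix y
      have "H y powr (- 1 / m) = 1 / (1 + l * q y)"
      proof -
        have pos: "0 < 1 + l * q y" using l by (simp add: q_def add_pos_nonneg)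
        have "H y powr (- 1 / m) = (1 + l * q y) powr (m * (- 1 / m))"
          unfolding H_def powr_realpow[OF pos, symmetric] powr_powr m(3) by (rule refl)
        also have "\<dots> = 1 / (1 + l * q y)" using pos m by (simp add: powr_minus_divide)
        finally show ?thesis .
      qed
      then have H: "(H y powr (- 1 / n)) powr (n / m) = 1 / (1 + l * q y)"
        using m by (simp add: powr_powr)
      have "(1 - n) * (n / m) = - n" using m by (simp add: field_simps)
      then have "(norm y powr (1 - n)) powr (n / m) = norm y powr - n"
        by (simp only: powr_powr)
      then have "(norm y powr (1 - n) * H y powr (- 1 / n)) powr (n / m) = norm y powr - n / (1 + l * q y)"
        by (subst powr_mult) (simp_all only: H powr_ge_zero times_divide_eq_right mult_1_right)
      then show "ennreal (v y powr (n / m)) =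
          ennreal (norm y powr - n / (1 + l * (norm y / \<rho>) powr - a)) * indicator (ball 0 \<rho>) y"
        by (simp add: v_def q_def indicator_def)
    qed
    also have "\<dots> = ennreal B"
      unfolding B_def V_def n_def using a l \<open>0 < \<rho>\<close> by (intro nn_integral_log_kernel)
    finally show ?thesis by simp
  qed
  have "ennreal (V * \<bar>f x\<bar>) \<le>
    (\<integral>\<^sup>+y. ennreal (norm y powr (1 - n)) * (ennreal (T y) * indicator (ball 0 \<rho>) y) \<partial>lborel)"
    unfolding V_def n_def T_def by (rule potential_bound[OF deriv cont \<open>0 < \<rho>\<close>])
  also have "\<dots> = (\<integral>\<^sup>+y. ennreal (u y * v y) \<partial>lborel)"
  proof (intro nn_integral_cong)
    fix y
    have "H y powr (1 / n) * H y powr (- 1 / n) = 1" using H[of y] by (simp flip: powr_add)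
    then have eq: "(T y * H y powr (1 / n)) * (norm y powr (1 - n) * H y powr (- 1 / n)) = norm y powr (1 - n) * T y"
      by simp
    show "ennreal (norm y powr (1 - n)) * (ennreal (T y) * indicator (ball 0 \<rho>) y) = ennreal (u y * v y)"
    proof (cases "y \<in> ball 0 \<rho>")
      case True
      then have "u y * v y = norm y powr (1 - n) * T y"
        unfolding u_def v_def eq[symmetric] by simp
      with True show ?thesis by (simp add: ennreal_mult')
    qed (simp add: u_def)
  qed
  also have "\<dots> \<le> ennreal (A powr (1 / n) * B powr (1 / (n / m)))"
  proof (rule nn_integral_Holder)
    show "u \<in> borel_measurable lborel" "v \<in> borel_measurable lborel"
      unfolding u_def v_def by measurable
    show "0 \<le> u y" "0 \<le> v y" for y using T[of y] by (auto simp: u_def v_def)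
    show "1 < n" "1 < n / m" "1 / n + 1 / (n / m) = 1" using m by (auto simp: field_simps)
  qed (use A B u_le v_le in auto)
  finally have "V * \<bar>f x\<bar> \<le> A powr (1 / n) * B powr (m / n)"
    by (subst (asm) ennreal_le_iff) auto
  then have "(V * \<bar>f x\<bar>) powr (n / m) \<le> (A powr (1 / n) * B powr (m / n)) powr (n / m)"
    using V m by (intro powr_mono2) auto
  also have "\<dots> = A powr (1 / m) * B" using A B m by (simp add: powr_mult powr_powr)
  finally have main: "V powr (n / m) * \<bar>f x\<bar> powr (n / m) \<le> A powr (1 / m) * B"
    using V by (simp add: powr_mult)
  \<comment> \<open>The exponent \<open>(2 * m + 1) / m\<close> is at most 3 because
    \<open>1 \<le> m\<close>.\<close>
  have A3: "A powr (1 / m) \<le> (1 + \<epsilon>) ^ 3"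
  proof -
    have "A powr (1 / m) = (1 + \<epsilon>) powr ((2 * m + 1) / m)"
    proof -
      have "A = (1 + \<epsilon>) powr (2 * m + 1)"
        unfolding A_def using \<epsilon> m(3) by (subst powr_realpow[symmetric]) (auto simp: algebra_simps)
      then show ?thesis by (simp only: powr_powr) simp
    qed
    also have "\<dots> \<le> (1 + \<epsilon>) powr 3" using \<epsilon> m(1) by (intro powr_mono) (auto simp: field_simps)
    finally show ?thesis using \<epsilon> by simp
  qed
  \<comment> \<open>The fourth power of \<open>1 + \<epsilon>\<close> comes from
    \<open>1 / a = m * (1 + \<epsilon>) / n\<close>; then the hypothesis on \<open>\<beta>\<close>
    cancels the constants exactly through
    \<open>V powr (n / m) = V * V powr (1 / m)\<close>.\<close>
  have "\<beta> * \<bar>f x\<bar> powr (n / m) \<le> m * ln ((1 + l) / l)"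
  proof -
    have L: "0 \<le> ln ((1 + l) / l)" using l by (intro ln_ge_zero) auto
    have Vm: "V powr (n / m) = V * V powr (1 / m)" 
    proof -
      have "n / m = 1 + 1 / m" using m(1,2) by (simp add: add_divide_distrib)
      then show ?thesis using V by (simp only: powr_add powr_one)
    qed
    have "V powr (n / m) * (\<beta> * \<bar>f x\<bar> powr (n / m)) \<le> \<beta> * (A powr (1 / m) * B)"
      using main \<beta> by (simp add: mult.left_commute)
    also have "\<dots> \<le> \<beta> * ((1 + \<epsilon>) ^ 3 * B)"
      using A3 \<beta> B by (intro mult_left_mono mult_right_mono) auto
    also have "\<dots> = (\<beta> * (1 + \<epsilon>) ^ 4) * (V * (m / n) * ln ((1 + l) / l))"
      using \<epsilon> m by (simp add: B_def a_def field_simps power4_eq_xxxx power3_eq_cube)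
    also have "\<dots> \<le> (n * V powr (1 / m)) * (V * (m / n) * ln ((1 + l) / l))"
      using \<beta> V m L unfolding V_def m_def by (intro mult_right_mono) auto
    also have "\<dots> = V powr (n / m) * (m * ln ((1 + l) / l))"
      unfolding Vm using m(5) by simp
    finally show ?thesis using V by simp
  qed
  also have "\<dots> \<le> m * ln (2 / l)" using l m by (intro mult_left_mono ln_mono divide_right_mono) auto
  finally have "exp (\<beta> * \<bar>f x\<bar> powr (n / m)) \<le> exp (m * ln (2 / l))" by simp
  also have "\<dots> = (2 / l) ^ Suc k" unfolding m(3) exp_of_nat_mult using l by simp
  also have "\<dots> = (2 / \<epsilon>) ^ Suc k * M"
  proof -
    have "2 / l = 2 / \<epsilon> * M powr (1 / m)" using \<epsilon> M by (simp add: l_def powr_minus field_simps)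
    then have "(2 / l) ^ Suc k = (2 / \<epsilon>) ^ Suc k * (M powr (1 / m)) ^ Suc k"
      by (simp only: power_mult_distrib)
    also have "(M powr (1 / m)) ^ Suc k = M" using M m by (subst powr_power) (auto simp: m(3))
    finally show ?thesis .
  qed
  finally have "ennreal (exp (\<beta> * \<bar>f x\<bar> powr (n / m))) \<le> ennreal ((2 / \<epsilon>) ^ Suc k * M)" by (rule ennreal_leI)
  also have "\<dots> = ennreal ((2 / \<epsilon>) ^ Suc k) * max 1 ?g" unfolding M(3) using M \<epsilon> by (intro ennreal_mult) auto
  finally show ?thesis by (simp add: k m_def)
qed

section \<open>The Young function and the weight\<close>

text \<open>As the tail of the exponential series from degree \<open>N - 1\<close> on,
  \<open>phi N\<close> can be compared termwise, which gives its positivity, monotonicity and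
  contraction property.\<close>

lemma phi_sums:
  assumes "2 \<le> N"
  shows "(\<lambda>j. t ^ (j + (N - 1)) / fact (j + (N - 1))) sums phi N t"
proof -
  have "(\<lambda>j. t ^ j / fact j) sums exp t"
    using exp_converges[of t] by (simp add: scaleR_conv_of_real field_simps)
  then have "(\<lambda>j. t ^ (j + (N - 1)) / fact (j + (N - 1))) sums (exp t - (\<Sum>j<N - 1. t ^ j / fact j))"
    by (rule sums_split_initial_segment)
  \<comment> \<open>Here \<open>2 \<le> N\<close> matters: for smaller \<open>N\<close> the
    truncated difference would leave the index 0 on the right and none on the left.\<close>
  moreover have "{..<N - 1} = {0..N - 2}" using assms by auto
  ultimately show ?thesis by (simp add: phi_def)
qed

lemma phi_nonneg: "2 \<le> N \<Longrightarrow> 0 \<le> t \<Longrightarrow> 0 \<le> phi N t"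
  using sums_le[OF _ sums_zero phi_sums] by simp

lemma phi_mono: "2 \<le> N \<Longrightarrow> 0 \<le> s \<Longrightarrow> s \<le> t \<Longrightarrow> phi N s \<le> phi N t"
  using sums_le[OF _ phi_sums phi_sums] by (simp add: divide_right_mono power_mono)

text \<open>All powers in the tail series have degree at least 1, so each of them gains at least a
  factor \<open>c\<close>. This is how a bounded modular is brought below 1 in the Luxemburg
  norm.\<close>

lemma phi_contract:
  assumes "2 \<le> N" "0 \<le> t" "0 \<le> c" "c \<le> 1"
  shows "phi N (c * t) \<le> c * phi N t"
proof (rule sums_le[OF _ phi_sums sums_mult[OF phi_sums]])
  fix j
  have "c ^ (j + (N - 1)) \<le> c ^ 1" using assms by (intro power_decreasing) auto
  then show "(c * t) ^ (j + (N - 1)) / fact (j + (N - 1)) \<le> c * (t ^ (j + (N - 1)) / fact (j + (N - 1)))"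
    using assms by (simp add: power_mult_distrib divide_right_mono mult_right_mono)
qed (use assms in auto)

lemma phi_le_exp: "2 \<le> N \<Longrightarrow> 0 \<le> t \<Longrightarrow> phi N t \<le> exp t"
  unfolding phi_def by (simp add: sum_nonneg)

text \<open>Lagrange form of the Taylor remainder. For
  \<open>t = \<beta> * \<bar>f x\<bar> powr (N / (N - 1))\<close> the power
  \<open>t ^ (N - 1)\<close> is a multiple of \<open>\<bar>f x\<bar> ^ N\<close>, so where
  \<open>t\<close> is bounded the energy controls \<open>phi N t\<close>.\<close>

lemma phi_le_power_exp:
  assumes "2 \<le> N" "0 \<le> t"
  shows "phi N t \<le> t ^ (N - 1) * exp t"
proof -
  obtain \<xi> where \<xi>: "\<bar>\<xi>\<bar> \<le> \<bar>t\<bar>" "exp t = (\<Sum>j<N - 1. t ^ j / fact j) + exp \<xi> / fact (N - 1) * t ^ (N - 1)"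
    using Maclaurin_exp_le[of t "N - 1"] by blast
  have "{..<N - 1} = {0..N - 2}" using assms by auto
  with \<xi> have "phi N t = exp \<xi> / fact (N - 1) * t ^ (N - 1)" by (simp add: phi_def)
  also have "\<dots> \<le> exp t * t ^ (N - 1)"
  proof (rule mult_right_mono)
    have "exp \<xi> / fact (N - 1) \<le> exp \<xi> / 1"
      by (intro divide_left_mono) (auto simp: fact_ge_1)
    also have "\<dots> \<le> exp t" using \<xi>(1) assms(2) by simp
    finally show "exp \<xi> / fact (N - 1) \<le> exp t" .
  qed (use assms in simp)
  finally show ?thesis by (simp add: mult.commute)
qed

lemma phi_measurable [measurable]: "phi N \<in> borel_measurable borel"
  unfolding phi_def[abs_def] by measurable

section \<open>Slow variation of the logarithmic weight and the weighted potential\<close>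

lemma log_weight_ge_1: "1 \<le> log_weight x"
proof -
  have "ln (exp 1) \<le> log_weight x" unfolding log_weight_def by (intro ln_mono) auto
  then show ?thesis by simp
qed

lemma log_weight_measurable [measurable]: "log_weight \<in> borel_measurable borel"
  unfolding log_weight_def[abs_def] by measurable

text \<open>The argument of the logarithm grows at most by the factor \<open>1 + R\<close>, hence
  the weight at most by the summand \<open>ln (1 + R)\<close>, and \<open>log_weight_ge_1\<close>
  turns the summand into a factor. That this factor is only logarithmic in \<open>R\<close> makes
  the later choice of a large \<open>R\<close> possible.\<close>

lemma log_weight_slowly_varying:
  assumes "norm y \<le> R"
  shows "log_weight (x + y) \<le> (1 + ln (1 + R)) * log_weight x"
proof -
  have R: "0 \<le> R" using assms norm_ge_zero[of y] by linarith
  have "norm (x + y) \<le> norm x + R" using norm_triangle_ineq[of x y] assms by linarith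
  moreover have "R \<le> exp 1 * R" using R by (simp add: mult_le_cancel_right1)
  moreover have "0 \<le> norm x * R" using R by simp
  ultimately have "exp 1 + norm (x + y) \<le> (exp 1 + norm x) * (1 + R)"
    by (simp add: algebra_simps)
  then have "log_weight (x + y) \<le> ln ((exp 1 + norm x) * (1 + R))"
    unfolding log_weight_def by (intro ln_mono) (auto simp: add_pos_nonneg)
  also have "\<dots> = log_weight x + ln (1 + R)"
    unfolding log_weight_def using R by (intro ln_mult_pos) (auto simp: add_pos_nonneg)
  also have "ln (1 + R) \<le> ln (1 + R) * log_weight x"
    using mult_left_mono[OF log_weight_ge_1[of x], of "ln (1 + R)"] R by simp
  finally show ?thesis by (simp add: algebra_simps)
qed

text \<open>By Fubini it suffices to integrate over \<open>x\<close> for a fixed source point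
  \<open>z\<close>. The radius satisfies \<open>\<rho> x powr N * log_weight x = R ^ N\<close>, so
  the kernel integral cancels the weight up to a constant; slow variation allows the weight at
  \<open>x\<close> to be replaced by the weight at \<open>z\<close>, at the cost of one factor
  \<open>C\<close> for the radius and one for the weight.\<close>

lemma weighted_potential_integral:
  fixes e :: "real ^ 'n::finite \<Rightarrow> real"
  defines "N \<equiv> CARD('n)"
  assumes [measurable]: "e \<in> borel_measurable borel" and e: "\<And>y. 0 \<le> e y"
    and R: "0 < R" and s: "0 \<le> s" "s < real N" and C: "C = 1 + ln (1 + R)"
    and \<rho>: "\<And>x. \<rho> x = R * log_weight x powr (- 1 / real N)"
  shows "(\<integral>\<^sup>+x. (\<integral>\<^sup>+y. ennreal (e (x + y) * (norm y / \<rho> x) powr - s) * indicator (ball 0 (\<rho> x)) y \<partial>lborel)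
      * ennreal (log_weight x) \<partial>lborel)
    \<le> ennreal (C\<^sup>2 * R ^ N * (real N * unit_ball_vol (real N)) / (real N - s)) * (\<integral>\<^sup>+y. ennreal (e y) \<partial>lborel)"
proof -
  have N: "0 < N" by (simp add: N_def)
  have C1: "1 \<le> C" using R by (simp add: C)
  have \<rho>_meas [measurable]: "\<rho> \<in> borel_measurable borel" unfolding \<rho>[abs_def] by measurable
  have \<rho>_pos: "0 < \<rho> x" for x using R log_weight_ge_1[of x] by (simp add: \<rho>)
  have \<rho>_le: "\<rho> x \<le> R" for x
  proof -
    have "log_weight x powr (- 1 / real N) \<le> log_weight x powr 0"
      using log_weight_ge_1[of x] by (intro powr_mono) auto
    then show ?thesis using R log_weight_ge_1[of x] by (simp add: \<rho>)
  qed
  \<comment> \<open>The ball of variable radius is written as a condition on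
    \<open>norm (z - x)\<close>, which makes the joint measurability required by Fubini
    visible.\<close>
  let ?k = "\<lambda>x z. if norm (z - x) < \<rho> x then ennreal (e z * (norm (z - x) / \<rho> x) powr - s) * ennreal (log_weight x) else 0"
  have inner: "(\<integral>\<^sup>+y. ennreal (e (x + y) * (norm y / \<rho> x) powr - s) * indicator (ball 0 (\<rho> x)) y \<partial>lborel)
      * ennreal (log_weight x) = (\<integral>\<^sup>+z. ?k x z \<partial>lborel)" for x
  proof -
    have [measurable]: "ball (0 :: real ^ 'n) (\<rho> x) \<in> sets borel" by simp
    have "(\<integral>\<^sup>+z. ?k x z \<partial>lborel) = (\<integral>\<^sup>+y. ?k x (x + y) \<partial>lborel)"
      by (rule nn_integral_lborel_translation) measurable
    also have "\<dots> = (\<integral>\<^sup>+y. ennreal (e (x + y) * (norm y / \<rho> x) powr - s) * indicator (ball 0 (\<rho> x)) y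
        * ennreal (log_weight x) \<partial>lborel)"
      by (intro nn_integral_cong) (simp add: indicator_def)
    also have "\<dots> = (\<integral>\<^sup>+y. ennreal (e (x + y) * (norm y / \<rho> x) powr - s) * indicator (ball 0 (\<rho> x)) y \<partial>lborel)
        * ennreal (log_weight x)"
      by (rule nn_integral_multc) measurable
    finally show ?thesis ..
  qed
  have outer: "(\<integral>\<^sup>+x. ?k x z \<partial>lborel)
      \<le> ennreal (C\<^sup>2 * R ^ N * (real N * unit_ball_vol (real N)) / (real N - s)) * ennreal (e z)" for z
  proof -
    \<comment> \<open>An upper bound for \<open>\<rho> x\<close> over all \<open>x\<close> whose
      ball contains \<open>z\<close>, because \<open>log_weight z \<le> C * log_weight x\<close> for
      such \<open>x\<close>.\<close>
    define r where "r = R * (log_weight z / C) powr (- 1 / real N)"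
    have lz: "0 < log_weight z" using log_weight_ge_1[of z] by linarith
    have r: "0 < r" using R C1 lz by (simp add: r_def)
    have rN: "r powr real N = R ^ N * C / log_weight z"
    proof -
      have "r powr real N = R powr real N * (log_weight z / C) powr - 1"
        unfolding r_def using R N by (simp add: powr_mult powr_powr)
      then show ?thesis using R C1 lz by (simp add: powr_realpow powr_minus_divide)
    qed
    have [measurable]: "ball (0 :: real ^ 'n) r \<in> sets borel" by simp
    have pt: "?k x z \<le> ennreal (C * log_weight z * e z) * (ennreal ((norm (- z + x) / r) powr - s) * indicator (ball 0 r) (- z + x))" for x
    proof (cases "norm (z - x) < \<rho> x")
      case True
      have nz: "norm (- z + x) = norm (z - x)" by (simp add: norm_minus_commute)
      have "norm (z - x) \<le> R" using True \<rho>_le[of x] by simp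
      then have "log_weight z \<le> C * log_weight x"
        using log_weight_slowly_varying[of "z - x" R x] by (simp add: C)
      then have "(log_weight x) powr (- 1 / real N) \<le> (log_weight z / C) powr (- 1 / real N)"
        using C1 lz N by (intro powr_mono2') (auto simp: field_simps)
      then have \<rho>r: "\<rho> x \<le> r" unfolding r_def \<rho> using R by simp
      have "log_weight x \<le> C * log_weight z"
        using log_weight_slowly_varying[of "x - z" R z] \<open>norm (z - x) \<le> R\<close> by (simp add: C norm_minus_commute)
      moreover have "(norm (z - x) / \<rho> x) powr - s \<le> (norm (z - x) / r) powr - s"
      proof (cases "z = x")
        case False
        then show ?thesis using r s \<rho>r \<rho>_pos[of x] by (intro powr_mono2' divide_left_mono) auto
      qed simp
      ultimately have "(norm (z - x) / \<rho> x) powr - s * log_weight x \<le> (norm (z - x) / r) powr - s * (C * log_weight z)"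
        using log_weight_ge_1[of x] by (intro mult_mono) auto
      then have "e z * ((norm (z - x) / \<rho> x) powr - s * log_weight x) \<le> e z * ((norm (z - x) / r) powr - s * (C * log_weight z))"
        using e by (rule mult_left_mono)
      then have "ennreal ((e z * (norm (z - x) / \<rho> x) powr - s) * log_weight x)
          \<le> ennreal ((C * log_weight z * e z) * (norm (z - x) / r) powr - s)"
        by (intro ennreal_leI) (simp add: mult_ac)
      also have "\<dots> = ennreal (C * log_weight z * e z) * ennreal ((norm (z - x) / r) powr - s)"
        using C1 lz e by (intro ennreal_mult) auto
      also have "ennreal ((e z * (norm (z - x) / \<rho> x) powr - s) * log_weight x)
          = ennreal (e z * (norm (z - x) / \<rho> x) powr - s) * ennreal (log_weight x)"
        using log_weight_ge_1[of x] e by (intro ennreal_mult) auto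
      finally have *: "ennreal (e z * (norm (z - x) / \<rho> x) powr - s) * ennreal (log_weight x)
          \<le> ennreal (C * log_weight z * e z) * ennreal ((norm (z - x) / r) powr - s)" .
      show ?thesis
      proof -
        have "indicator (ball 0 r) (- z + x) = (1 :: ennreal)" using True \<rho>r nz by simp
        then show ?thesis using True *
          by (simp only: nz if_True mult_1_right)
      qed
    qed simp
    have "(\<integral>\<^sup>+x. ?k x z \<partial>lborel)
      \<le> (\<integral>\<^sup>+x. ennreal (C * log_weight z * e z) * (ennreal ((norm (- z + x) / r) powr - s) * indicator (ball 0 r) (- z + x)) \<partial>lborel)"
      by (intro nn_integral_mono pt)
    also have "\<dots> = ennreal (C * log_weight z * e z) * (\<integral>\<^sup>+x. ennreal ((norm (- z + x) / r) powr - s) * indicator (ball 0 r) (- z + x) \<partial>lborel)"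
      by (rule nn_integral_cmult) measurable
    also have "(\<integral>\<^sup>+x. ennreal ((norm (- z + x) / r) powr - s) * indicator (ball 0 r) (- z + x) \<partial>lborel)
      = (\<integral>\<^sup>+y. ennreal ((norm y / r) powr - s) * indicator (ball 0 r) (y :: real ^ 'n) \<partial>lborel)"
      by (rule nn_integral_lborel_translation[symmetric]) measurable
    also have "\<dots> = ennreal (real N * unit_ball_vol (real N) / (real N - s) * r powr real N)"
      using nn_integral_power_kernel[where 'a = "real ^ 'n", of s r] r s by (simp add: N_def)
    also have "ennreal (C * log_weight z * e z) * \<dots> =
      ennreal ((C\<^sup>2 * R ^ N * (real N * unit_ball_vol (real N)) / (real N - s)) * e z)"
    proof -
      have eq: "(C * log_weight z * e z) * (real N * unit_ball_vol (real N) / (real N - s) * r powr real N)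
        = (C\<^sup>2 * R ^ N * (real N * unit_ball_vol (real N)) / (real N - s)) * e z"
        unfolding rN using lz by (simp add: power2_eq_square)
      have pos: "0 \<le> C * log_weight z * e z" using C1 lz e by simp
      show ?thesis by (simp only: ennreal_mult'[OF pos, symmetric] eq)
    qed
    also have "\<dots> = ennreal (C\<^sup>2 * R ^ N * (real N * unit_ball_vol (real N)) / (real N - s)) * ennreal (e z)"
      by (rule ennreal_mult'') (rule e)
    finally show ?thesis .
  qed
  have "(\<integral>\<^sup>+x. (\<integral>\<^sup>+y. ennreal (e (x + y) * (norm y / \<rho> x) powr - s) * indicator (ball 0 (\<rho> x)) y \<partial>lborel)
      * ennreal (log_weight x) \<partial>lborel) = (\<integral>\<^sup>+x. (\<integral>\<^sup>+z. ?k x z \<partial>lborel) \<partial>lborel)"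
    by (simp only: inner)
  also have "\<dots> = (\<integral>\<^sup>+z. (\<integral>\<^sup>+x. ?k x z \<partial>lborel) \<partial>lborel)"
    by (rule lborel_pair.Fubini'[symmetric]) (simp only: split_beta', measurable)
  also have "\<dots> \<le> (\<integral>\<^sup>+z. ennreal (C\<^sup>2 * R ^ N * (real N * unit_ball_vol (real N)) / (real N - s)) * ennreal (e z) \<partial>lborel)"
    by (intro nn_integral_mono outer)
  also have "\<dots> = ennreal (C\<^sup>2 * R ^ N * (real N * unit_ball_vol (real N)) / (real N - s)) * (\<integral>\<^sup>+z. ennreal (e z) \<partial>lborel)"
    by (rule nn_integral_cmult) measurable
  finally show ?thesis .
qed

section \<open>Test functions\<close>

lemma exists_epsilon_below_threshold:
  fixes \<alpha> \<beta> :: real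
  assumes "0 < \<beta>" "\<beta> < \<alpha>"
  obtains \<epsilon> where "0 < \<epsilon>" "\<epsilon> \<le> 1" "\<beta> * (1 + \<epsilon>) ^ 4 \<le> \<alpha>"
proof -
  have "((\<lambda>\<epsilon>. \<beta> * (1 + \<epsilon>) ^ 4) \<longlongrightarrow> \<beta> * (1 + 0) ^ 4) (at_right 0)"
    by (intro tendsto_intros)
  then have "\<forall>\<^sub>F \<epsilon> in at_right 0. \<beta> * (1 + \<epsilon>) ^ 4 < \<alpha>"
    using assms by (intro order_tendstoD(2)[where a = \<alpha>]) auto
  moreover have "\<forall>\<^sub>F \<epsilon> in at_right (0::real). \<epsilon> \<in> {0<..<1}"
    by (rule eventually_at_right_real) simp
  ultimately have "\<forall>\<^sub>F \<epsilon> in at_right 0. 0 < \<epsilon> \<and> \<epsilon> < 1 \<and> \<beta> * (1 + \<epsilon>) ^ 4 < \<alpha>"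
    by eventually_elim simp
  then obtain \<epsilon> where "0 < \<epsilon> \<and> \<epsilon> < 1 \<and> \<beta> * (1 + \<epsilon>) ^ 4 < \<alpha>"
    using eventually_happens trivial_limit_at_right_real by blast
  then show ?thesis using that[of \<epsilon>] by auto
qed

text \<open>The bound depends on \<open>f\<close> only through the energy hypothesis. Allowing
  energy \<open>1 + \<epsilon>\<close> rather than 1 leaves room for test functions that approximate
  an element of the closed unit ball.\<close>

lemma test_function_phi_bound:
  fixes f :: "real ^ 'n::finite \<Rightarrow> real"
  defines "N \<equiv> CARD('n)"
  assumes N: "2 \<le> N" and \<epsilon>: "0 < \<epsilon>" "\<epsilon> \<le> 1"
    and \<beta>: "0 < \<beta>" "\<beta> * (1 + \<epsilon>) ^ 4 \<le> alpha_N TYPE('n)"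
    and f: "test_function f" and E: "w_energy f (grad f) \<le> ennreal (1 + \<epsilon>)"
    and R_def: "R = 2 / \<epsilon> ^ N" and C: "C = 1 + ln (1 + R)" and D: "D = (2 / \<epsilon>) ^ (N - 1)"
  shows "(\<integral>\<^sup>+x. ennreal (phi N (\<beta> * \<bar>f x\<bar> powr (real N / (real N - 1))) * log_weight x) \<partial>lborel)
    \<le> ennreal ((D * \<beta> ^ (N - 1) + D * (C\<^sup>2 * R ^ N * (real N * unit_ball_vol (real N)) / (real N - real N / (1 + \<epsilon>)))) * (1 + \<epsilon>))"
proof -
  note [measurable] = test_function_measurable[OF f]
  define s where "s = real N / (1 + \<epsilon>)"
  have s: "0 \<le> s" "s < real N" using N \<epsilon> by (auto simp: s_def field_simps)
  \<comment> \<open>The choice of \<open>R\<close> gives \<open>\<epsilon> ^ N * R = 2\<close>,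
    whence \<open>C \<le> 2 * R = \<epsilon> ^ N * R\<^sup>2\<close>, and \<open>2 \<le> N\<close>
    raises the exponent of \<open>R\<close> to \<open>N\<close>.\<close>
  have R: "1 \<le> R" "C \<le> (\<epsilon> * R) ^ N"
  proof -
    have "\<epsilon> ^ N \<le> 1" using \<epsilon> by (simp add: power_le_one)
    then show R1: "1 \<le> R" using \<epsilon> by (simp add: R_def)
    have "ln (1 + R) \<le> R" using R1 by (intro ln_add_one_self_le_self) simp
    then have "C \<le> 2 * R" using R1 by (simp add: C)
    also have "\<dots> = \<epsilon> ^ N * R ^ 2" using \<epsilon> by (simp add: R_def power2_eq_square field_simps)
    also have "\<dots> \<le> \<epsilon> ^ N * R ^ N" using R1 N \<epsilon> by (intro mult_left_mono power_increasing) auto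
    finally show "C \<le> (\<epsilon> * R) ^ N" by (simp add: power_mult_distrib)
  qed
  have C1: "1 \<le> C" using R by (simp add: C)
  define e where "e y = norm (grad f y) ^ N + \<bar>f y\<bar> ^ N * log_weight y" for y
  have lw: "1 \<le> log_weight y" for y :: "real ^ 'n" by (rule log_weight_ge_1)
  have lw0: "0 \<le> log_weight y" for y :: "real ^ 'n" using lw[of y] by linarith
  have e: "0 \<le> e y" for y using lw0[of y] by (simp add: e_def)
  have e_meas [measurable]: "e \<in> borel_measurable borel" unfolding e_def[abs_def] by measurable
  have e_int: "(\<integral>\<^sup>+y. ennreal (e y) \<partial>lborel) \<le> ennreal (1 + \<epsilon>)"
  proof -
    have "(\<integral>\<^sup>+y. ennreal (e y) \<partial>lborel) = (\<integral>\<^sup>+y. ennreal (norm (grad f y) ^ N) \<partial>lborel)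
        + (\<integral>\<^sup>+y. ennreal (\<bar>f y\<bar> ^ N * log_weight y) \<partial>lborel)"
      using lw0 by (subst nn_integral_add[symmetric]) (simp_all add: e_def)
    also have "\<dots> = w_energy f (grad f)" by (simp add: w_energy_def nn_integral_completion N_def)
    finally show ?thesis using E by simp
  qed
  have f_int: "(\<integral>\<^sup>+y. ennreal (\<bar>f y\<bar> ^ N * log_weight y) \<partial>lborel) \<le> ennreal (1 + \<epsilon>)"
    by (rule order_trans[OF _ e_int]) (intro nn_integral_mono ennreal_leI, simp add: e_def)
  define \<rho> where "\<rho> x = R * log_weight x powr (- 1 / real N)" for x :: "real ^ 'n"
  have \<rho>: "0 < \<rho> x" "\<rho> x \<le> R" for x
  proof -
    show "0 < \<rho> x" using R lw[of x] by (simp add: \<rho>_def)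
    have "log_weight x powr (- 1 / real N) \<le> log_weight x powr 0"
      using lw[of x] by (intro powr_mono) auto
    then show "\<rho> x \<le> R" using R lw[of x] by (simp add: \<rho>_def)
  qed
  have \<rho>_meas [measurable]: "\<rho> \<in> borel_measurable borel" unfolding \<rho>_def[abs_def] by measurable
  \<comment> \<open>By slow variation and \<open>C \<le> (\<epsilon> * R) ^ N\<close>, the cut-off
    term \<open>\<bar>f\<bar> / \<rho> x\<close> is at most \<open>\<epsilon> * b\<close>, where
    \<open>b ^ N\<close> is the weighted part of \<open>e\<close>. Convexity with
    \<open>h = \<epsilon>\<close> then separates it from the gradient.\<close>
  have le_e: "(norm (grad f (x + y)) + \<bar>f (x + y)\<bar> / \<rho> x) ^ N \<le> (1 + \<epsilon>) ^ (N - 1) * e (x + y)"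
    if "norm y < \<rho> x" for x y
  proof -
    obtain k where k: "N = Suc k" using N by (metis Suc_le_D numeral_2_eq_2)
    define b where "b = \<bar>f (x + y)\<bar> * log_weight (x + y) powr (1 / real N)"
    have "log_weight x \<le> C * log_weight (x + y)"
      using log_weight_slowly_varying[of "- y" R "x + y"] \<rho>(2)[of x] that by (simp add: C)
    also have "\<dots> \<le> (\<epsilon> * R) ^ N * log_weight (x + y)" using R lw0 by (intro mult_right_mono) auto
    finally have "log_weight x powr (1 / real N) \<le> ((\<epsilon> * R) ^ N * log_weight (x + y)) powr (1 / real N)"
      using lw0 by (intro powr_mono2) auto
    also have "\<dots> = \<epsilon> * R * log_weight (x + y) powr (1 / real N)"
      using R \<epsilon> N by (simp add: powr_mult powr_powr flip: powr_realpow)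
    finally have "\<bar>f (x + y)\<bar> * log_weight x powr (1 / real N) \<le> \<bar>f (x + y)\<bar> * (\<epsilon> * R * log_weight (x + y) powr (1 / real N))"
      by (rule mult_left_mono) simp
    then have "\<bar>f (x + y)\<bar> / \<rho> x \<le> \<epsilon> * b"
      using R by (simp add: \<rho>_def b_def powr_minus field_simps)
    then have "(norm (grad f (x + y)) + \<bar>f (x + y)\<bar> / \<rho> x) ^ N \<le> (norm (grad f (x + y)) + \<epsilon> * b) ^ N"
      using \<rho>(1)[of x] by (intro power_mono add_nonneg_nonneg) (auto intro: less_imp_le)
    also have "\<dots> \<le> (1 + \<epsilon>) ^ (N - 1) * (norm (grad f (x + y)) ^ N + \<epsilon> * b ^ N)"
      unfolding k using \<epsilon> convex_combination_power_le[of "norm (grad f (x + y))" b \<epsilon> k] by (simp add: b_def)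
    also have "\<dots> \<le> (1 + \<epsilon>) ^ (N - 1) * (norm (grad f (x + y)) ^ N + b ^ N)"
      using \<epsilon> by (intro mult_left_mono add_left_mono mult_left_le_one_le) (auto simp: b_def)
    also have "b ^ N = \<bar>f (x + y)\<bar> ^ N * log_weight (x + y)"
      using lw[of "x + y"] N by (simp add: b_def power_mult_distrib powr_power)
    finally show ?thesis by (simp add: e_def)
  qed
  define g where "g x = (\<integral>\<^sup>+y. ennreal (e (x + y) * (norm y / \<rho> x) powr - s) * indicator (ball 0 (\<rho> x)) y \<partial>lborel)" for x
  have g_meas [measurable]: "g \<in> borel_measurable borel"
  proof -
    have "g = (\<lambda>x. \<integral>\<^sup>+y. (if norm y < \<rho> x then ennreal (e (x + y) * (norm y / \<rho> x) powr - s) else 0) \<partial>lborel)"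
      unfolding g_def by (intro ext nn_integral_cong) (simp add: indicator_def)
    then show ?thesis by (simp only:) measurable
  qed
  have D1: "1 \<le> D" unfolding D using \<epsilon> by (intro one_le_power) simp
  have pt: "ennreal (phi N (\<beta> * \<bar>f x\<bar> powr (real N / (real N - 1))))
      \<le> ennreal (D * \<beta> ^ (N - 1)) * ennreal (\<bar>f x\<bar> ^ N) + ennreal D * g x" for x
  proof -
    define t where "t = \<beta> * \<bar>f x\<bar> powr (real N / (real N - 1))"
    have t: "0 \<le> t" using \<beta> by (simp add: t_def)
    have dim: "DIM(real ^ 'n) = N" by (simp add: N_def)
    have exp_bound: "ennreal (exp t) \<le> ennreal D * max 1 (g x)"
      unfolding t_def g_def s_def D
    proof (rule exp_potential_bound[where 'a = "real ^ 'n", unfolded dim])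
      show "\<beta> * (1 + \<epsilon>) ^ 4 \<le> real N * (real N * unit_ball_vol (real N)) powr (1 / (real N - 1))"
        using \<beta>(2) by (simp add: alpha_N_def sphere_area_eq N_def)
    qed (use test_function_has_derivative[OF f] test_function_continuous_grad[OF f] \<rho> N \<epsilon> \<beta> e e_int le_e in auto)
    show ?thesis
    \<comment> \<open>If \<open>exp t \<le> D\<close>, then \<open>t\<close> is bounded and
      \<open>phi N t\<close> is comparable to \<open>\<bar>f x\<bar> ^ N\<close>. Otherwise the
      maximum in \<open>exp_bound\<close> must be \<open>g x\<close>, which then dominates the
      exponential.\<close>
    proof (cases "exp t \<le> D")
      case True
      have "t ^ (N - 1) = \<beta> ^ (N - 1) * \<bar>f x\<bar> ^ N"
      proof -
        have "(\<bar>f x\<bar> powr (real N / (real N - 1))) ^ (N - 1) = \<bar>f x\<bar> ^ N"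
        proof (cases "f x = 0")
          case False
          then have "(\<bar>f x\<bar> powr (real N / (real N - 1))) ^ (N - 1) = \<bar>f x\<bar> powr real N"
            using N by (subst powr_power) auto
          then show ?thesis using False by (simp add: powr_realpow)
        qed (use N in \<open>simp add: power_0_left\<close>)
        then show ?thesis by (simp add: t_def power_mult_distrib)
      qed
      moreover have "phi N t \<le> t ^ (N - 1) * exp t" by (rule phi_le_power_exp[OF N t])
      moreover have "t ^ (N - 1) * exp t \<le> t ^ (N - 1) * D" using True t by (intro mult_left_mono) auto
      ultimately have "phi N t \<le> (D * \<beta> ^ (N - 1)) * \<bar>f x\<bar> ^ N" by (simp add: mult_ac)
      then have "ennreal (phi N t) \<le> ennreal ((D * \<beta> ^ (N - 1)) * \<bar>f x\<bar> ^ N)" by (rule ennreal_leI)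
      also have "\<dots> = ennreal (D * \<beta> ^ (N - 1)) * ennreal (\<bar>f x\<bar> ^ N)" by (rule ennreal_mult'') simp
      finally show ?thesis unfolding t_def[symmetric] by (rule add_increasing2[rotated]) simp
    next
      case False
      have "1 < g x"
      proof (rule ccontr)
        assume "\<not> 1 < g x"
        then have "ennreal (exp t) \<le> ennreal D" using exp_bound by (simp add: max_def split: if_splits)
        then show False using False D1 by (simp add: ennreal_le_iff)
      qed
      then have "ennreal (exp t) \<le> ennreal D * g x" using exp_bound by (simp add: max_absorb2 less_imp_le)
      moreover have "ennreal (phi N t) \<le> ennreal (exp t)" by (intro ennreal_leI phi_le_exp N t)
      ultimately have "ennreal (phi N t) \<le> ennreal D * g x" by (rule order_trans[rotated])
      then show ?thesis unfolding t_def[symmetric] by (rule add_increasing[rotated]) simp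
    qed
  qed
  let ?K = "C\<^sup>2 * R ^ N * (real N * unit_ball_vol (real N)) / (real N - s)"
  have K: "0 \<le> ?K" using C1 R s by simp
  have "(\<integral>\<^sup>+x. ennreal (phi N (\<beta> * \<bar>f x\<bar> powr (real N / (real N - 1))) * log_weight x) \<partial>lborel)
      \<le> (\<integral>\<^sup>+x. ennreal (D * \<beta> ^ (N - 1)) * ennreal (\<bar>f x\<bar> ^ N * log_weight x) + ennreal D * (g x * ennreal (log_weight x)) \<partial>lborel)"
  proof (rule nn_integral_mono)
    fix x
    have "ennreal (phi N (\<beta> * \<bar>f x\<bar> powr (real N / (real N - 1))) * log_weight x)
        = ennreal (phi N (\<beta> * \<bar>f x\<bar> powr (real N / (real N - 1)))) * ennreal (log_weight x)"
      by (rule ennreal_mult'') (rule lw0)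
    also have "\<dots> \<le> (ennreal (D * \<beta> ^ (N - 1)) * ennreal (\<bar>f x\<bar> ^ N) + ennreal D * g x) * ennreal (log_weight x)"
      by (rule mult_right_mono[OF pt]) simp
    also have "\<dots> = ennreal (D * \<beta> ^ (N - 1)) * ennreal (\<bar>f x\<bar> ^ N * log_weight x) + ennreal D * (g x * ennreal (log_weight x))"
      by (simp add: ennreal_mult''[OF lw0] distrib_right mult.assoc)
    finally show "ennreal (phi N (\<beta> * \<bar>f x\<bar> powr (real N / (real N - 1))) * log_weight x) \<le> \<dots>" .
  qed
  also have "\<dots> = ennreal (D * \<beta> ^ (N - 1)) * (\<integral>\<^sup>+x. ennreal (\<bar>f x\<bar> ^ N * log_weight x) \<partial>lborel)
      + ennreal D * (\<integral>\<^sup>+x. g x * ennreal (log_weight x) \<partial>lborel)"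
    by (simp add: nn_integral_add nn_integral_cmult)
  also have "\<dots> \<le> ennreal (D * \<beta> ^ (N - 1)) * ennreal (1 + \<epsilon>) + ennreal D * (ennreal ?K * ennreal (1 + \<epsilon>))"
  proof (intro add_mono mult_left_mono f_int)
    have "(\<integral>\<^sup>+x. g x * ennreal (log_weight x) \<partial>lborel) \<le> ennreal ?K * (\<integral>\<^sup>+y. ennreal (e y) \<partial>lborel)"
      unfolding g_def N_def using R s C e \<rho>_def
      by (intro weighted_potential_integral) (auto simp: N_def)
    also have "\<dots> \<le> ennreal ?K * ennreal (1 + \<epsilon>)" by (intro mult_left_mono e_int) simp
    finally show "(\<integral>\<^sup>+x. g x * ennreal (log_weight x) \<partial>lborel) \<le> ennreal ?K * ennreal (1 + \<epsilon>)" .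
  qed auto
  also have "\<dots> = ennreal ((D * \<beta> ^ (N - 1) + D * ?K) * (1 + \<epsilon>))"
  proof -
    have *: "ennreal p * ennreal u + ennreal q * (ennreal K * ennreal u) = ennreal ((p + q * K) * u)"
      if "0 \<le> p" "0 \<le> q" "0 \<le> K" "0 \<le> u" for p q K u
      using that by (simp add: ennreal_mult' distrib_right mult.assoc)
    show ?thesis by (rule *) (use D1 \<beta> K \<epsilon> in auto)
  qed
  finally show ?thesis by (simp only: s_def)
qed

section \<open>The completion\<close>

lemma partial_deriv_lincomb:
  fixes f g :: "real ^ 'n::finite \<Rightarrow> real"
  assumes "\<And>x. f differentiable (at x)" "\<And>x. g differentiable (at x)"
  shows "partial_deriv i (\<lambda>x. a * f x + b * g x) = (\<lambda>x. a * partial_deriv i f x + b * partial_deriv i g x)"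
proof
  fix x
  have "((\<lambda>x. a * f x + b * g x) has_derivative
      (\<lambda>h. a * frechet_derivative f (at x) h + b * frechet_derivative g (at x) h)) (at x)"
    using assms by (intro has_derivative_add has_derivative_mult_right) (auto simp: frechet_derivative_works[symmetric])
  from frechet_derivative_at[OF this]
  show "partial_deriv i (\<lambda>x. a * f x + b * g x) x = a * partial_deriv i f x + b * partial_deriv i g x"
    by (simp add: partial_deriv_def fun_eq_iff)
qed

lemma Ck_lincomb:
  fixes f g :: "real ^ 'n::finite \<Rightarrow> real"
  assumes "Ck k f" "Ck k g"
  shows "Ck k (\<lambda>x. a * f x + b * g x)"
  using assms
proof (induction k arbitrary: f g)
  case 0
  then show ?case by (auto intro!: continuous_intros)
next
  case (Suc k)
  then have "partial_deriv i (\<lambda>x. a * f x + b * g x) = (\<lambda>x. a * partial_deriv i f x + b * partial_deriv i g x)" for i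
    by (intro partial_deriv_lincomb) auto
  with Suc show ?case by (auto intro!: derivative_intros)
qed

lemma test_function_lincomb:
  fixes f g :: "real ^ 'n::finite \<Rightarrow> real"
  assumes "test_function f" "test_function g"
  shows "test_function (\<lambda>x. a * f x + b * g x)"
    and "grad (\<lambda>x. a * f x + b * g x) = (\<lambda>x. a *\<^sub>R grad f x + b *\<^sub>R grad g x)"
proof -
  have C: "Ck k f" "Ck k g" for k using assms unfolding test_function_def by auto
  have "closure {x. a * f x + b * g x \<noteq> 0} \<subseteq> closure ({x. f x \<noteq> 0} \<union> {x. g x \<noteq> 0})"
    by (intro closure_mono) auto
  moreover have "compact (closure ({x. f x \<noteq> 0} \<union> {x. g x \<noteq> 0}))"
    using assms unfolding test_function_def closure_Un by (intro compact_Un) auto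
  ultimately have "compact (closure {x. a * f x + b * g x \<noteq> 0})"
    unfolding compact_eq_bounded_closed using bounded_subset by blast
  then show "test_function (\<lambda>x. a * f x + b * g x)"
    using C Ck_lincomb unfolding test_function_def by blast
  have "\<And>x. f differentiable (at x)" "\<And>x. g differentiable (at x)" using C[of 1] by auto
  then show "grad (\<lambda>x. a * f x + b * g x) = (\<lambda>x. a *\<^sub>R grad f x + b *\<^sub>R grad g x)"
    by (simp add: fun_eq_iff grad_def partial_deriv_lincomb vec_eq_iff)
qed

lemma test_function_bounded:
  assumes "test_function f"
  obtains M where "\<And>x. \<bar>f x\<bar> \<le> M"
proof -
  let ?S = "closure {x. f x \<noteq> 0}"
  have "compact (f ` ?S)"
    using assms test_function_continuous[OF assms] unfolding test_function_def
    by (intro compact_continuous_image) (auto intro: continuous_on_subset)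
  then have "\<exists>M. \<forall>x\<in>?S. \<bar>f x\<bar> \<le> M"
    by (auto dest!: compact_imp_bounded simp: bounded_iff)
  then obtain M where M: "\<And>x. x \<in> ?S \<Longrightarrow> \<bar>f x\<bar> \<le> M" by blast
  have "\<bar>f x\<bar> \<le> max M 0" for x
    using M[of x] closure_subset[of "{x. f x \<noteq> 0}"] by (cases "f x = 0") auto
  then show ?thesis using that by blast
qed

text \<open>Both integrands are continuous and vanish off the compact support; the gradient does so
  because \<open>f\<close> is 0 on the open complement.\<close>

lemma test_function_finite_energy:
  fixes f :: "real ^ 'n::finite \<Rightarrow> real"
  assumes "test_function f"
  shows "w_energy f (grad f) < \<infinity>"
proof -
  define S where "S = closure {x. f x \<noteq> 0}"
  have f_zero: "f x = 0" if "x \<notin> S" for x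
    using that closure_subset[of "{x. f x \<noteq> 0}"] unfolding S_def by blast
  have "closed S" by (simp add: S_def)
  have S: "compact S" using assms by (simp add: test_function_def S_def)
  have zero: "f x = 0 \<and> grad f x = 0" if "x \<notin> S" for x
  proof
    show "f x = 0" using that by (rule f_zero)
    have "(f has_derivative (\<lambda>h. 0)) (at x)"
    proof (rule has_derivative_transform_within_open)
      show "((\<lambda>x. 0) has_derivative (\<lambda>h. 0)) (at x)" by simp
      show "open (- S)" "x \<in> - S" using that \<open>closed S\<close> by auto
      show "0 = f y" if "y \<in> - S" for y
        using f_zero[of y] that by simp
    qed
    from frechet_derivative_at[OF this] show "grad f x = 0"
      by (simp add: grad_def partial_deriv_def vec_eq_iff fun_eq_iff)
  qed
  have fin: "(\<integral>\<^sup>+x. ennreal (h x) \<partial>lborel) < \<infinity>"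
    if h: "continuous_on UNIV h" "\<And>x. x \<notin> S \<Longrightarrow> h x = 0" for h :: "real ^ 'n \<Rightarrow> real"
  proof -
    have "compact (h ` S)"
      using S h(1) by (intro compact_continuous_image) (auto intro: continuous_on_subset)
    then have "\<exists>M. \<forall>x\<in>S. \<bar>h x\<bar> \<le> M"
      by (auto dest!: compact_imp_bounded simp: bounded_iff)
    then obtain M where M: "\<And>x. x \<in> S \<Longrightarrow> \<bar>h x\<bar> \<le> M" by blast
    have "ennreal (h x) \<le> ennreal M * indicator S x" for x
    proof (cases "x \<in> S")
      case True
      then show ?thesis using M[OF True] by (simp add: ennreal_leI)
    qed (simp add: h(2))
    then have "(\<integral>\<^sup>+x. ennreal (h x) \<partial>lborel) \<le> (\<integral>\<^sup>+x. ennreal M * indicator S x \<partial>lborel)"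
      by (intro nn_integral_mono)
    also have "\<dots> = ennreal M * emeasure lborel S"
      using \<open>closed S\<close> by (intro nn_integral_cmult_indicator) auto
    also have "\<dots> < \<infinity>"
      using emeasure_compact_finite[OF S] by (simp add: ennreal_mult_less_top)
    finally show ?thesis .
  qed
  have cw: "continuous_on UNIV (log_weight :: real ^ 'n \<Rightarrow> real)"
    unfolding log_weight_def[abs_def]
    by (intro continuous_intros) (metis add_pos_nonneg exp_gt_zero norm_ge_zero order_less_irrefl)
  have "(\<integral>\<^sup>+x. ennreal (norm (grad f x) ^ CARD('n)) \<partial>lborel) < \<infinity>"
  proof (rule fin)
    show "continuous_on UNIV (\<lambda>x. norm (grad f x) ^ CARD('n))"
      by (rule continuous_on_power[OF continuous_on_norm[OF test_function_continuous_grad[OF assms]]])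
  qed (simp add: zero)
  moreover have "(\<integral>\<^sup>+x. ennreal (\<bar>f x\<bar> ^ CARD('n) * log_weight x) \<partial>lborel) < \<infinity>"
  proof (rule fin)
    show "continuous_on UNIV (\<lambda>x. \<bar>f x\<bar> ^ CARD('n) * log_weight x)"
      by (rule continuous_on_mult[OF continuous_on_power[OF continuous_on_rabs[OF test_function_continuous[OF assms]]] cw])
  qed (simp add: zero)
  ultimately show ?thesis
    by (simp add: w_energy_def nn_integral_completion)
qed

lemma lebesgue_measurable_of_borel:
  "f \<in> borel_measurable borel \<Longrightarrow> f \<in> borel_measurable lebesgue"
  by (simp add: measurable_completion)

lemma w_energy_scale:
  fixes u :: "real ^ 'n::finite \<Rightarrow> real"
  assumes [measurable]: "u \<in> borel_measurable lebesgue" "G \<in> borel_measurable lebesgue"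
  shows "w_energy (\<lambda>x. a * u x) (\<lambda>x. a *\<^sub>R G x) = ennreal (\<bar>a\<bar> ^ CARD('n)) * w_energy u G"
proof -
  note [measurable] = lebesgue_measurable_of_borel[OF log_weight_measurable]
  have *: "ennreal (\<bar>a * u x\<bar> ^ CARD('n) * log_weight x) = ennreal (\<bar>a\<bar> ^ CARD('n)) * ennreal (\<bar>u x\<bar> ^ CARD('n) * log_weight x)" for x
    by (subst ennreal_mult'[symmetric]) (auto simp: power_mult_distrib abs_mult mult.assoc)
  have **: "ennreal (norm (a *\<^sub>R G x) ^ CARD('n)) = ennreal (\<bar>a\<bar> ^ CARD('n)) * ennreal (norm (G x) ^ CARD('n))" for x
    by (subst ennreal_mult'[symmetric]) (auto simp: power_mult_distrib)
  show ?thesis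
    unfolding w_energy_def * ** by (simp add: nn_integral_cmult distrib_left)
qed

text \<open>A substitute for Minkowski's inequality at the level of \<open>N\<close>-th powers, from
  convexity applied to \<open>u + d * (v / d)\<close>. If the energies are at most 1 and
  \<open>d ^ N\<close>, the bound is \<open>(1 + d) ^ N\<close>, the value that the triangle
  inequality would give.\<close>

lemma w_energy_add_le:
  fixes u v :: "real ^ 'n::finite \<Rightarrow> real"
  assumes [measurable]: "u \<in> borel_measurable lebesgue" "G \<in> borel_measurable lebesgue"
    "v \<in> borel_measurable lebesgue" "H \<in> borel_measurable lebesgue" and d: "0 < d"
  shows "w_energy (\<lambda>x. u x + v x) (\<lambda>x. G x + H x)
    \<le> ennreal ((1 + d) ^ (CARD('n) - 1)) * (w_energy u G + ennreal (d / d ^ CARD('n)) * w_energy v H)"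
proof -
  note [measurable] = lebesgue_measurable_of_borel[OF log_weight_measurable]
  let ?N = "CARD('n)"
  obtain k where k: "?N = Suc k" using zero_less_card_finite[where 'a = 'n] by (metis gr0_implies_Suc)
  have real_bound: "c ^ ?N \<le> (1 + d) ^ (?N - 1) * (a ^ ?N + d / d ^ ?N * b ^ ?N)"
    if "0 \<le> a" "0 \<le> b" "0 \<le> c" "c \<le> a + b" for a b c :: real
  proof -
    have "c ^ ?N \<le> (a + d * (b / d)) ^ ?N" using that d by (intro power_mono) auto
    also have "\<dots> \<le> (1 + d) ^ k * (a ^ ?N + d * (b / d) ^ ?N)"
      unfolding k using that d by (intro convex_combination_power_le) auto
    finally show ?thesis using d by (simp add: k power_divide)
  qed
  have bound: "ennreal (c ^ ?N * w) \<le> ennreal ((1 + d) ^ (?N - 1)) * (ennreal (a ^ ?N * w) + ennreal (d / d ^ ?N) * ennreal (b ^ ?N * w))"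
    if "0 \<le> a" "0 \<le> b" "0 \<le> c" "c \<le> a + b" "0 \<le> w" for a b c w :: real
  proof -
    have "ennreal (c ^ ?N * w) \<le> ennreal ((1 + d) ^ (?N - 1) * (a ^ ?N + d / d ^ ?N * b ^ ?N) * w)"
      using real_bound[of a b c] that by (intro ennreal_leI mult_right_mono) auto
    also have "(1 + d) ^ (?N - 1) * (a ^ ?N + d / d ^ ?N * b ^ ?N) * w
        = (1 + d) ^ (?N - 1) * (a ^ ?N * w + d / d ^ ?N * (b ^ ?N * w))"
      by (simp add: algebra_simps)
    also have "ennreal \<dots> = ennreal ((1 + d) ^ (?N - 1)) * (ennreal (a ^ ?N * w) + ennreal (d / d ^ ?N) * ennreal (b ^ ?N * w))"
    proof -
      have *: "ennreal (p * (q + r * s)) = ennreal p * (ennreal q + ennreal r * ennreal s)"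
        if "0 \<le> p" "0 \<le> q" "0 \<le> r" "0 \<le> s" for p q r s
        using that by (simp add: ennreal_mult')
      show ?thesis by (rule *) (use d that in auto)
    qed
    finally show ?thesis .
  qed
  have lw: "0 \<le> log_weight x" for x :: "real ^ 'n" using log_weight_ge_1[of x] by linarith
  have "w_energy (\<lambda>x. u x + v x) (\<lambda>x. G x + H x) \<le>
    (\<integral>\<^sup>+x. ennreal ((1 + d) ^ (?N - 1)) * (ennreal (norm (G x) ^ ?N) + ennreal (d / d ^ ?N) * ennreal (norm (H x) ^ ?N)) \<partial>lebesgue) +
    (\<integral>\<^sup>+x. ennreal ((1 + d) ^ (?N - 1)) * (ennreal (\<bar>u x\<bar> ^ ?N * log_weight x) + ennreal (d / d ^ ?N) * ennreal (\<bar>v x\<bar> ^ ?N * log_weight x)) \<partial>lebesgue)"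
    unfolding w_energy_def
  proof (intro add_mono nn_integral_mono)
    fix x
    show "ennreal (norm (G x + H x) ^ ?N) \<le>
        ennreal ((1 + d) ^ (?N - 1)) * (ennreal (norm (G x) ^ ?N) + ennreal (d / d ^ ?N) * ennreal (norm (H x) ^ ?N))"
      using bound[of "norm (G x)" "norm (H x)" "norm (G x + H x)" 1] norm_triangle_ineq[of "G x" "H x"] by simp
    show "ennreal (\<bar>u x + v x\<bar> ^ ?N * log_weight x) \<le> ennreal ((1 + d) ^ (?N - 1)) *
        (ennreal (\<bar>u x\<bar> ^ ?N * log_weight x) + ennreal (d / d ^ ?N) * ennreal (\<bar>v x\<bar> ^ ?N * log_weight x))"
      using lw by (intro bound) auto
  qed
  also have "\<dots> = ennreal ((1 + d) ^ (?N - 1)) * (w_energy u G + ennreal (d / d ^ ?N) * w_energy v H)"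
    unfolding w_energy_def by (simp add: nn_integral_cmult nn_integral_add distrib_left add_ac)
  finally show ?thesis .
qed

text \<open>If \<open>f k\<close> approximates \<open>u\<close>, then \<open>a * f k + b * h\<close>
  misses the new limit by exactly \<open>a\<close> times the old error, since the contribution of
  \<open>h\<close> cancels.\<close>

lemma w_limit_lincomb:
  fixes u h :: "real ^ 'n::finite \<Rightarrow> real"
  assumes u: "w_limit u G" and h: "test_function h"
  shows "w_limit (\<lambda>x. a * u x + b * h x) (\<lambda>x. a *\<^sub>R G x + b *\<^sub>R grad h x)"
proof -
  from u obtain f where f: "\<And>k. test_function (f k)"
      and lim: "(\<lambda>k. w_energy (\<lambda>x. f k x - u x) (\<lambda>x. grad (f k) x - G x)) \<longlonglongrightarrow> 0"
      and meas [measurable]: "u \<in> borel_measurable lebesgue" "G \<in> borel_measurable lebesgue"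
    unfolding w_limit_def by blast
  note [measurable] = test_function_measurable[OF h, THEN lebesgue_measurable_of_borel]
  define f' where "f' k = (\<lambda>x. a * f k x + b * h x)" for k
  have f': "test_function (f' k)" "grad (f' k) = (\<lambda>x. a *\<^sub>R grad (f k) x + b *\<^sub>R grad h x)" for k
    unfolding f'_def by (rule test_function_lincomb[OF f h])+
  have eq: "w_energy (\<lambda>x. f' k x - (a * u x + b * h x)) (\<lambda>x. grad (f' k) x - (a *\<^sub>R G x + b *\<^sub>R grad h x))
    = ennreal (\<bar>a\<bar> ^ CARD('n)) * w_energy (\<lambda>x. f k x - u x) (\<lambda>x. grad (f k) x - G x)" for k
  proof -
    note [measurable] = test_function_measurable[OF f[of k], THEN lebesgue_measurable_of_borel]
    have "(\<lambda>x. f' k x - (a * u x + b * h x)) = (\<lambda>x. a * (f k x - u x))"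
      "(\<lambda>x. grad (f' k) x - (a *\<^sub>R G x + b *\<^sub>R grad h x)) = (\<lambda>x. a *\<^sub>R (grad (f k) x - G x))"
      unfolding f'(2) by (auto simp: f'_def algebra_simps)
    then show ?thesis by (simp only:) (rule w_energy_scale, measurable)
  qed
  have "(\<lambda>k. ennreal (\<bar>a\<bar> ^ CARD('n)) * w_energy (\<lambda>x. f k x - u x) (\<lambda>x. grad (f k) x - G x)) \<longlonglongrightarrow> ennreal (\<bar>a\<bar> ^ CARD('n)) * 0"
    by (intro ennreal_tendsto_cmult lim) simp
  then have conv: "(\<lambda>k. w_energy (\<lambda>x. f' k x - (a * u x + b * h x)) (\<lambda>x. grad (f' k) x - (a *\<^sub>R G x + b *\<^sub>R grad h x))) \<longlonglongrightarrow> 0"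
    by (simp add: eq)
  have "(\<lambda>x. a * u x + b * h x) \<in> borel_measurable lebesgue"
    "(\<lambda>x. a *\<^sub>R G x + b *\<^sub>R grad h x) \<in> borel_measurable lebesgue"
    by measurable
  then show ?thesis unfolding w_limit_def using f'(1) conv by blast
qed

lemma alpha_N_pos: "0 < alpha_N TYPE('n::finite)"
proof -
  have "0 < sphere_area TYPE('n)" by (simp add: sphere_area_eq)
  then show ?thesis by (simp add: alpha_N_def)
qed

lemma phi_tendsto:
  assumes "(f \<longlongrightarrow> a) F"
  shows "((\<lambda>x. phi N (f x)) \<longlongrightarrow> phi N a) F"
  unfolding phi_def using assms by (intro tendsto_intros) auto

lemma w_limit_measurable:
  assumes "w_limit u G"
  shows "u \<in> borel_measurable lebesgue" "G \<in> borel_measurable lebesgue"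
  using assms by (auto simp: w_limit_def)

lemma w_limit_phi_bound:
  fixes \<beta> :: real
  assumes N: "2 \<le> CARD('n::finite)" and \<beta>: "0 < \<beta>" "\<beta> < alpha_N TYPE('n)"
  obtains K :: real where "\<And>(u :: real ^ 'n \<Rightarrow> real) G. w_limit u G \<Longrightarrow> w_energy u G \<le> 1 \<Longrightarrow>
    (\<integral>\<^sup>+x. ennreal (phi CARD('n) (\<beta> * \<bar>u x\<bar> powr (real CARD('n) / (real CARD('n) - 1))) * log_weight x) \<partial>lebesgue) \<le> ennreal K"
proof -
  let ?N = "CARD('n)"
  define p where "p = real ?N / (real ?N - 1)"
  have p: "0 < p" using N by (simp add: p_def)
  obtain \<epsilon> where \<epsilon>: "0 < \<epsilon>" "\<epsilon> \<le> 1" "\<beta> * (1 + \<epsilon>) ^ 4 \<le> alpha_N TYPE('n)"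
    using exists_epsilon_below_threshold[OF \<beta>] by blast
  obtain K where K: "\<And>f :: real ^ 'n \<Rightarrow> real. test_function f \<Longrightarrow> w_energy f (grad f) \<le> ennreal (1 + \<epsilon>) \<Longrightarrow>
      (\<integral>\<^sup>+x. ennreal (phi ?N (\<beta> * \<bar>f x\<bar> powr p) * log_weight x) \<partial>lebesgue) \<le> ennreal K"
    unfolding p_def nn_integral_completion
    using test_function_phi_bound[OF N \<epsilon>(1,2) \<beta>(1) \<epsilon>(3) _ _ refl refl refl] by blast
  \<comment> \<open>Approximants within energy \<open>d ^ N\<close> of a point of the unit ball then
    have energy at most \<open>(1 + d) ^ N = 1 + \<epsilon>\<close>.\<close>
  define d where "d = (1 + \<epsilon>) powr (1 / real ?N) - 1"
  have d: "0 < d" "(1 + d) ^ ?N = 1 + \<epsilon>"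
  proof -
    have "1 < (1 + \<epsilon>) powr (1 / real ?N)" using \<epsilon> by (intro gr_one_powr) auto
    then show "0 < d" by (simp add: d_def)
    show "(1 + d) ^ ?N = 1 + \<epsilon>" using \<epsilon> by (simp add: d_def powr_power)
  qed
  show ?thesis
  proof (rule that)
    fix u :: "real ^ 'n \<Rightarrow> real" and G
    assume u: "w_limit u G" and E: "w_energy u G \<le> 1"
    then obtain f where f: "\<And>k. test_function (f k)"
      and lim: "(\<lambda>k. w_energy (\<lambda>x. f k x - u x) (\<lambda>x. grad (f k) x - G x)) \<longlonglongrightarrow> 0"
      unfolding w_limit_def by blast
    note [measurable] = w_limit_measurable[OF u] lebesgue_measurable_of_borel[OF log_weight_measurable]
    have "\<forall>\<^sub>F k in sequentially. w_energy (\<lambda>x. f k x - u x) (\<lambda>x. grad (f k) x - G x) < ennreal (d ^ ?N)"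
      by (rule order_tendstoD(2)[OF lim]) (use d in simp)
    then obtain k0 where k0: "\<And>k. k0 \<le> k \<Longrightarrow> w_energy (\<lambda>x. f k x - u x) (\<lambda>x. grad (f k) x - G x) < ennreal (d ^ ?N)"
      unfolding eventually_sequentially by blast
    have E_f: "w_energy (f k) (grad (f k)) \<le> ennreal (1 + \<epsilon>)" if "k0 \<le> k" for k
    proof -
      note [measurable] = test_function_measurable[OF f[of k], THEN lebesgue_measurable_of_borel]
      have m: "(\<lambda>x. f k x - u x) \<in> borel_measurable lebesgue"
        "(\<lambda>x. grad (f k) x - G x) \<in> borel_measurable lebesgue"
        by measurable
      have "w_energy (f k) (grad (f k)) = w_energy (\<lambda>x. u x + (f k x - u x)) (\<lambda>x. G x + (grad (f k) x - G x))"
        by simp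
      also have "\<dots> \<le> ennreal ((1 + d) ^ (?N - 1)) *
          (w_energy u G + ennreal (d / d ^ ?N) * w_energy (\<lambda>x. f k x - u x) (\<lambda>x. grad (f k) x - G x))"
        by (rule w_energy_add_le[OF w_limit_measurable[OF u] m d(1)])
      also have "\<dots> \<le> ennreal ((1 + d) ^ (?N - 1)) * (1 + ennreal (d / d ^ ?N) * ennreal (d ^ ?N))"
        using k0[OF that] by (intro mult_left_mono add_mono E) auto
      also have "\<dots> = ennreal ((1 + d) ^ (?N - 1) * (1 + d))"
        using d(1) by (simp add: ennreal_mult'[symmetric] ennreal_1[symmetric] flip: ennreal_plus del: ennreal_1)
      also have "(1 + d) ^ (?N - 1) * (1 + d) = 1 + \<epsilon>"
        using d(2) power_minus_mult[of ?N "1 + d"] by simp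
      finally show ?thesis .
    qed
    \<comment> \<open>The shift by \<open>k0\<close> drops the terms with too large an energy.
      Convergence in the weighted \<open>N\<close>-th mean is convergence of \<open>h k\<close> to 0
      in the first mean, which yields an almost everywhere convergent subsequence.\<close>
    define h where "h k x = \<bar>f (k + k0) x - u x\<bar> ^ ?N * log_weight x" for k x
    have h_meas [measurable]: "h k \<in> borel_measurable lebesgue" for k
    proof -
      note [measurable] = test_function_measurable(1)[OF f[of "k + k0"], THEN lebesgue_measurable_of_borel]
      show ?thesis unfolding h_def[abs_def] by measurable
    qed
    have h_nonneg: "0 \<le> h k x" for k x using log_weight_ge_1[of x] by (simp add: h_def)
    have h_le: "(\<integral>\<^sup>+x. ennreal (h k x) \<partial>lebesgue) \<le> w_energy (\<lambda>x. f (k + k0) x - u x) (\<lambda>x. grad (f (k + k0)) x - G x)" for k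
      unfolding w_energy_def h_def by simp
    have h_int: "integrable lebesgue (h k)" for k
    proof (rule integrableI_nonneg)
      show "(\<integral>\<^sup>+x. ennreal (h k x) \<partial>lebesgue) < \<infinity>"
        using order.strict_trans1[OF h_le k0, of k] by (simp add: less_top order.strict_trans2)
    qed (use h_nonneg in auto)
    have "(\<lambda>k. \<integral>\<^sup>+x. ennreal (h k x) \<partial>lebesgue) \<longlonglongrightarrow> 0"
      by (rule tendsto_sandwich[OF _ _ tendsto_const LIMSEQ_ignore_initial_segment[OF lim, of k0]])
         (simp, rule always_eventually, rule allI, rule h_le)
    then have "(\<lambda>k. ennreal (\<integral>x. norm (h k x) \<partial>lebesgue)) \<longlonglongrightarrow> ennreal 0"
      using h_nonneg by (simp add: nn_integral_eq_integral[OF h_int])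
    then have "(\<lambda>k. \<integral>x. norm (h k x) \<partial>lebesgue) \<longlonglongrightarrow> 0"
      by (subst (asm) tendsto_ennreal_iff) auto
    from tendsto_L1_AE_subseq[OF h_int this]
    obtain r where r: "strict_mono r" "AE x in lebesgue. (\<lambda>k. h (r k) x) \<longlonglongrightarrow> 0" by blast
    define q where "q v x = phi ?N (\<beta> * \<bar>v\<bar> powr p) * log_weight x" for v :: real and x :: "real ^ 'n"
    have AE_conv: "AE x in lebesgue. (\<lambda>k. ennreal (q (f (r k + k0) x) x)) \<longlonglongrightarrow> ennreal (q (u x) x)"
      using r(2)
    proof (rule eventually_mono)
      fix x assume x: "(\<lambda>k. h (r k) x) \<longlonglongrightarrow> 0"
      \<comment> \<open>The weight is at least 1 and may be dropped.\<close>
      have "(\<lambda>k. \<bar>f (r k + k0) x - u x\<bar> ^ ?N) \<longlonglongrightarrow> 0"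
      proof (rule tendsto_sandwich[OF _ _ tendsto_const x])
        show "\<forall>\<^sub>F k in sequentially. \<bar>f (r k + k0) x - u x\<bar> ^ ?N \<le> h (r k) x"
          using log_weight_ge_1[of x] by (simp add: h_def mult_le_cancel_left1)
      qed simp
      then have "(\<lambda>k. root ?N (\<bar>f (r k + k0) x - u x\<bar> ^ ?N)) \<longlonglongrightarrow> root ?N 0"
        by (rule tendsto_real_root)
      then have "(\<lambda>k. \<bar>f (r k + k0) x - u x\<bar>) \<longlonglongrightarrow> 0"
        by (simp add: real_root_power_cancel)
      then have "(\<lambda>k. f (r k + k0) x) \<longlonglongrightarrow> u x"
        by (rule LIM_zero_cancel[OF tendsto_rabs_zero_cancel])
      then have "(\<lambda>k. \<bar>f (r k + k0) x\<bar> powr p) \<longlonglongrightarrow> \<bar>u x\<bar> powr p"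
        using p by (intro tendsto_powr' tendsto_rabs tendsto_const) auto
      then have "(\<lambda>k. q (f (r k + k0) x) x) \<longlonglongrightarrow> q (u x) x"
        unfolding q_def by (intro tendsto_mult phi_tendsto tendsto_const)
      then show "(\<lambda>k. ennreal (q (f (r k + k0) x) x)) \<longlonglongrightarrow> ennreal (q (u x) x)"
        by (rule tendsto_ennrealI)
    qed
    have "(\<integral>\<^sup>+x. ennreal (q (u x) x) \<partial>lebesgue)
        = (\<integral>\<^sup>+x. liminf (\<lambda>k. ennreal (q (f (r k + k0) x) x)) \<partial>lebesgue)"
      by (rule nn_integral_cong_AE, rule eventually_mono[OF AE_conv])
         (rule lim_imp_Liminf[symmetric], simp_all)
    also have "\<dots> \<le> liminf (\<lambda>k. \<integral>\<^sup>+x. ennreal (q (f (r k + k0) x) x) \<partial>lebesgue)"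
    proof (rule nn_integral_liminf)
      fix k
      note [measurable] = test_function_measurable(1)[OF f[of "r k + k0"], THEN lebesgue_measurable_of_borel]
      show "(\<lambda>x. ennreal (q (f (r k + k0) x) x)) \<in> borel_measurable lebesgue"
        unfolding q_def by measurable
    qed
    also have "\<dots> \<le> liminf (\<lambda>k. ennreal K)"
      unfolding q_def by (intro Liminf_mono always_eventually allI K f E_f) simp
    also have "\<dots> = ennreal K" by (simp add: Liminf_const)
    finally show "(\<integral>\<^sup>+x. ennreal (phi ?N (\<beta> * \<bar>u x\<bar> powr (real ?N / (real ?N - 1))) * log_weight x) \<partial>lebesgue) \<le> ennreal K"
      by (simp add: q_def p_def)
  qed
qed

text \<open>Writing \<open>u\<close> as an approximant minus its error,
  \<open>w_energy_add_le\<close> with \<open>d = 1\<close> bounds its energy by finite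
  quantities.\<close>

lemma w_limit_finite_energy:
  fixes u :: "real ^ 'n::finite \<Rightarrow> real"
  assumes u: "w_limit u G"
  shows "w_energy u G < \<infinity>"
proof -
  obtain f where f: "\<And>k. test_function (f k)"
    and lim: "(\<lambda>k. w_energy (\<lambda>x. f k x - u x) (\<lambda>x. grad (f k) x - G x)) \<longlonglongrightarrow> 0"
    using u unfolding w_limit_def by blast
  have "\<forall>\<^sub>F k in sequentially. w_energy (\<lambda>x. f k x - u x) (\<lambda>x. grad (f k) x - G x) < 1"
    by (rule order_tendstoD(2)[OF lim]) simp
  then obtain k where k: "w_energy (\<lambda>x. f k x - u x) (\<lambda>x. grad (f k) x - G x) < 1"
    by (auto simp: eventually_sequentially)
  note [measurable] = w_limit_measurable[OF u] test_function_measurable[OF f[of k], THEN lebesgue_measurable_of_borel]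
  note mf = test_function_measurable[OF f[of k], THEN lebesgue_measurable_of_borel]
  have m: "(\<lambda>x. (- 1) * (f k x - u x)) \<in> borel_measurable lebesgue"
    "(\<lambda>x. (- 1) *\<^sub>R (grad (f k) x - G x)) \<in> borel_measurable lebesgue"
    by measurable
  have "w_energy u G = w_energy (\<lambda>x. f k x + (- 1) * (f k x - u x)) (\<lambda>x. grad (f k) x + (- 1) *\<^sub>R (grad (f k) x - G x))"
    by simp
  also have "\<dots> \<le> ennreal ((1 + 1) ^ (CARD('n) - 1)) * (w_energy (f k) (grad (f k)) + ennreal (1 / 1 ^ CARD('n)) *
      w_energy (\<lambda>x. (- 1) * (f k x - u x)) (\<lambda>x. (- 1) *\<^sub>R (grad (f k) x - G x)))"
    by (rule w_energy_add_le[OF mf m zero_less_one])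
  also have "w_energy (\<lambda>x. (- 1) * (f k x - u x)) (\<lambda>x. (- 1) *\<^sub>R (grad (f k) x - G x))
      = ennreal (\<bar>- 1\<bar> ^ CARD('n)) * w_energy (\<lambda>x. f k x - u x) (\<lambda>x. grad (f k) x - G x)"
    by (rule w_energy_scale) measurable
  also have "ennreal ((1 + 1) ^ (CARD('n) - 1)) * (w_energy (f k) (grad (f k)) + ennreal (1 / 1 ^ CARD('n)) *
      (ennreal (\<bar>- 1\<bar> ^ CARD('n)) * w_energy (\<lambda>x. f k x - u x) (\<lambda>x. grad (f k) x - G x))) < \<infinity>"
    using test_function_finite_energy[OF f[of k]] order.strict_trans[OF k, of top]
    by (auto simp: ennreal_mult_less_top ennreal_add_less_top)
  finally show ?thesis .
qed

text \<open>A large \<open>\<alpha>\<close> is absorbed by scaling the approximation error: the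
  error can be made so small that, multiplied by \<open>1 / d\<close>, it still lies in the unit
  ball, where the uniform bound for \<open>\<beta>\<close> holds.\<close>

lemma w_limit_phi_finite:
  fixes u :: "real ^ 'n::finite \<Rightarrow> real"
  assumes N: "2 \<le> CARD('n)" and u: "w_limit u G" and \<alpha>: "0 < \<alpha>"
  shows "(\<integral>\<^sup>+x. ennreal (phi CARD('n) (\<alpha> * \<bar>u x\<bar> powr (real CARD('n) / (real CARD('n) - 1))) * log_weight x) \<partial>lebesgue) < \<infinity>"
proof -
  let ?N = "CARD('n)"
  define p where "p = real ?N / (real ?N - 1)"
  have p: "0 < p" using N by (simp add: p_def)
  define \<beta> where "\<beta> = alpha_N TYPE('n) / 2"
  have \<beta>: "0 < \<beta>" "\<beta> < alpha_N TYPE('n)" using alpha_N_pos[where 'n = 'n] by (auto simp: \<beta>_def)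
  obtain K where K: "\<And>(u :: real ^ 'n \<Rightarrow> real) G. w_limit u G \<Longrightarrow> w_energy u G \<le> 1 \<Longrightarrow>
    (\<integral>\<^sup>+x. ennreal (phi ?N (\<beta> * \<bar>u x\<bar> powr p) * log_weight x) \<partial>lebesgue) \<le> ennreal K"
    unfolding p_def using w_limit_phi_bound[OF N \<beta>] by blast
  \<comment> \<open>Chosen so that \<open>\<bar>u x\<bar> \<le> 2 * d * \<bar>v x\<bar>\<close>
    implies \<open>\<alpha> * \<bar>u x\<bar> powr p \<le> \<beta> * \<bar>v x\<bar> powr
    p\<close>.\<close>
  define d where "d = (\<beta> / \<alpha>) powr (1 / p) / 2"
  have d: "0 < d" "\<alpha> * (2 * d) powr p = \<beta>"
    using \<alpha> \<beta> p by (auto simp: d_def powr_powr)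
  obtain f where f: "\<And>k. test_function (f k)"
    and lim: "(\<lambda>k. w_energy (\<lambda>x. f k x - u x) (\<lambda>x. grad (f k) x - G x)) \<longlonglongrightarrow> 0"
    using u unfolding w_limit_def by blast
  have "\<forall>\<^sub>F k in sequentially. w_energy (\<lambda>x. f k x - u x) (\<lambda>x. grad (f k) x - G x) < ennreal (d ^ ?N)"
    by (rule order_tendstoD(2)[OF lim]) (use d in simp)
  then obtain k where k: "w_energy (\<lambda>x. f k x - u x) (\<lambda>x. grad (f k) x - G x) < ennreal (d ^ ?N)"
    by (auto simp: eventually_sequentially)
  note [measurable] = w_limit_measurable[OF u] test_function_measurable[OF f[of k], THEN lebesgue_measurable_of_borel]
    lebesgue_measurable_of_borel[OF log_weight_measurable]
  define v where "v x = (- 1 / d) * u x + (1 / d) * f k x" for x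
  have v_eq: "v x = (1 / d) * (f k x - u x)" for x by (simp add: v_def algebra_simps)
  have vm [measurable]: "v \<in> borel_measurable lebesgue" unfolding v_def[abs_def] by measurable
  have "w_limit v (\<lambda>x. (- 1 / d) *\<^sub>R G x + (1 / d) *\<^sub>R grad (f k) x)"
    unfolding v_def[abs_def] by (rule w_limit_lincomb[OF u f])
  moreover have "w_energy v (\<lambda>x. (- 1 / d) *\<^sub>R G x + (1 / d) *\<^sub>R grad (f k) x) \<le> 1"
  proof -
    have "w_energy v (\<lambda>x. (- 1 / d) *\<^sub>R G x + (1 / d) *\<^sub>R grad (f k) x)
      = w_energy (\<lambda>x. (1 / d) * (f k x - u x)) (\<lambda>x. (1 / d) *\<^sub>R (grad (f k) x - G x))"
      by (simp add: v_eq[abs_def] algebra_simps)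
    also have "\<dots> = ennreal (\<bar>1 / d\<bar> ^ ?N) * w_energy (\<lambda>x. f k x - u x) (\<lambda>x. grad (f k) x - G x)"
      by (rule w_energy_scale) measurable
    also have "\<dots> \<le> ennreal (\<bar>1 / d\<bar> ^ ?N) * ennreal (d ^ ?N)"
      using k by (intro mult_left_mono) auto
    also have "\<dots> = 1" using d by (simp add: ennreal_mult'[symmetric] power_divide)
    finally show ?thesis .
  qed
  ultimately have v_int: "(\<integral>\<^sup>+x. ennreal (phi ?N (\<beta> * \<bar>v x\<bar> powr p) * log_weight x) \<partial>lebesgue) \<le> ennreal K"
    by (rule K)
  obtain M where M: "\<And>x. \<bar>f k x\<bar> \<le> M" using test_function_bounded[OF f] by blast
  define T where "T = \<alpha> * (2 * M) powr p"
  define c where "c = \<alpha> ^ (?N - 1) * exp T"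
  have c: "0 \<le> c" using \<alpha> by (simp add: c_def)
  have pt: "phi ?N (\<alpha> * \<bar>u x\<bar> powr p) \<le> phi ?N (\<beta> * \<bar>v x\<bar> powr p) + c * \<bar>u x\<bar> ^ ?N" for x
  proof -
    have tri: "\<bar>u x\<bar> \<le> \<bar>f k x\<bar> + \<bar>f k x - u x\<bar>" by (simp add: abs_if)
    have two: "a \<le> 2 * m" if "a \<le> b + c" "b \<le> m" "c \<le> m" for a b c m :: real
      using that by linarith
    show ?thesis
    \<comment> \<open>Where the error exceeds the bound \<open>M\<close> of the test function, it
      controls \<open>u\<close> up to the factor 2. Elsewhere
      \<open>\<bar>u x\<bar> \<le> 2 * M\<close>, and \<open>phi\<close> is dominated by
      \<open>\<bar>u x\<bar> ^ N\<close>, which has finite weighted integral.\<close>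
    proof (cases "M \<le> \<bar>f k x - u x\<bar>")
      case True
      then have "\<bar>u x\<bar> \<le> 2 * \<bar>f k x - u x\<bar>"
        using tri M[of x] by (intro two[of _ "\<bar>f k x\<bar>" "\<bar>f k x - u x\<bar>"]) (rule tri, rule order_trans, auto)
      then have "\<bar>u x\<bar> \<le> 2 * d * \<bar>v x\<bar>" using d(1) by (simp add: v_eq abs_mult)
      then have "\<alpha> * \<bar>u x\<bar> powr p \<le> \<alpha> * (2 * d * \<bar>v x\<bar>) powr p"
        using \<alpha> p by (intro mult_left_mono powr_mono2) auto
      also have "\<dots> = \<beta> * \<bar>v x\<bar> powr p" using d by (simp add: powr_mult flip: d(2))
      finally have "phi ?N (\<alpha> * \<bar>u x\<bar> powr p) \<le> phi ?N (\<beta> * \<bar>v x\<bar> powr p)"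
        using \<alpha> by (intro phi_mono N) auto
      then show ?thesis using c by (simp add: add_increasing2)
    next
      case False
      then have "\<bar>u x\<bar> \<le> 2 * M"
        by (intro two[OF tri M]) simp
      then have le: "\<alpha> * \<bar>u x\<bar> powr p \<le> T"
        unfolding T_def using \<alpha> p by (intro mult_left_mono powr_mono2) auto
      have "(\<bar>u x\<bar> powr p) ^ (?N - 1) = \<bar>u x\<bar> ^ ?N"
      proof (cases "u x = 0")
        case False
        then have "(\<bar>u x\<bar> powr p) ^ (?N - 1) = \<bar>u x\<bar> powr real ?N"
          unfolding p_def using N by (subst powr_power) auto
        then show ?thesis using False by (simp add: powr_realpow)
      qed (use N in \<open>simp add: power_0_left\<close>)
      then have pw: "(\<alpha> * \<bar>u x\<bar> powr p) ^ (?N - 1) = \<alpha> ^ (?N - 1) * \<bar>u x\<bar> ^ ?N"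
        by (simp add: power_mult_distrib)
      have "phi ?N (\<alpha> * \<bar>u x\<bar> powr p) \<le> (\<alpha> * \<bar>u x\<bar> powr p) ^ (?N - 1) * exp (\<alpha> * \<bar>u x\<bar> powr p)"
        using \<alpha> by (intro phi_le_power_exp N) auto
      also have "\<dots> \<le> (\<alpha> ^ (?N - 1) * \<bar>u x\<bar> ^ ?N) * exp T"
        unfolding pw using le \<alpha> by (intro mult_left_mono) auto
      also have "\<dots> = c * \<bar>u x\<bar> ^ ?N" by (simp add: c_def)
      finally show ?thesis using phi_nonneg[OF N, of "\<beta> * \<bar>v x\<bar> powr p"] \<beta> by simp
    qed
  qed
  have "(\<integral>\<^sup>+x. ennreal (phi ?N (\<alpha> * \<bar>u x\<bar> powr p) * log_weight x) \<partial>lebesgue)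
    \<le> (\<integral>\<^sup>+x. ennreal (phi ?N (\<beta> * \<bar>v x\<bar> powr p) * log_weight x) + ennreal c * ennreal (\<bar>u x\<bar> ^ ?N * log_weight x) \<partial>lebesgue)"
  proof (rule nn_integral_mono)
    fix x :: "real ^ 'n"
    have lw: "0 \<le> log_weight x" using log_weight_ge_1[of x] by linarith
    have "ennreal (phi ?N (\<alpha> * \<bar>u x\<bar> powr p) * log_weight x)
        \<le> ennreal (phi ?N (\<beta> * \<bar>v x\<bar> powr p) * log_weight x + c * (\<bar>u x\<bar> ^ ?N * log_weight x))"
      using mult_right_mono[OF pt lw, of x] by (intro ennreal_leI) (simp add: algebra_simps)
    also have "\<dots> = ennreal (phi ?N (\<beta> * \<bar>v x\<bar> powr p) * log_weight x) + ennreal c * ennreal (\<bar>u x\<bar> ^ ?N * log_weight x)"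
      using phi_nonneg[OF N, of "\<beta> * \<bar>v x\<bar> powr p"] \<beta> lw c by (subst ennreal_plus) (auto simp: ennreal_mult')
    finally show "ennreal (phi ?N (\<alpha> * \<bar>u x\<bar> powr p) * log_weight x) \<le> \<dots>" .
  qed
  also have "\<dots> = (\<integral>\<^sup>+x. ennreal (phi ?N (\<beta> * \<bar>v x\<bar> powr p) * log_weight x) \<partial>lebesgue)
      + ennreal c * (\<integral>\<^sup>+x. ennreal (\<bar>u x\<bar> ^ ?N * log_weight x) \<partial>lebesgue)"
    by (simp add: nn_integral_add nn_integral_cmult)
  also have "\<dots> < \<infinity>"
  proof -
    have "(\<integral>\<^sup>+x. ennreal (\<bar>u x\<bar> ^ ?N * log_weight x) \<partial>lebesgue) < \<infinity>"
      using w_limit_finite_energy[OF u] by (simp add: w_energy_def)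
    then show ?thesis
      using order.strict_trans1[OF v_int, of top] by (auto simp: ennreal_mult_less_top)
  qed
  finally show ?thesis by (simp add: p_def)
qed

section \<open>Orlicz norms\<close>

lemma w_grad_w_limit:
  assumes "u \<in> W1N_w"
  shows "w_limit u (w_grad u)"
  using assms unfolding W1N_w_def w_grad_def by (simp add: someI_ex)

text \<open>Finiteness of the energy is what allows \<open>enn2real\<close> and the root in
  \<open>w_norm\<close> to be undone.\<close>

lemma w_energy_w_grad:
  fixes u :: "real ^ 'n::finite \<Rightarrow> real"
  assumes "u \<in> W1N_w"
  shows "w_energy u (w_grad u) = ennreal (w_norm u ^ CARD('n))"
proof -
  have "w_energy u (w_grad u) < top"
    using w_limit_finite_energy[OF w_grad_w_limit[OF assms]] by simp
  then have "w_energy u (w_grad u) = ennreal (enn2real (w_energy u (w_grad u)))"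
    by simp
  then show ?thesis
    by (simp add: w_norm_def real_root_pow_pos2)
qed

lemma w_norm_nonneg: "0 \<le> w_norm u"
  by (simp add: w_norm_def real_root_ge_zero)

lemma young_phi_measurable [measurable]: "young_phi N \<in> borel_measurable borel"
  unfolding young_phi_def[abs_def] by measurable

lemma log_modular_eq:
  fixes u :: "real ^ 'n::finite \<Rightarrow> real"
  assumes [measurable]: "u \<in> borel_measurable lebesgue"
  shows "orlicz_modular log_measure (young_phi N) u
    = (\<integral>\<^sup>+x. ennreal (phi N (\<bar>u x\<bar> powr (real N / (real N - 1))) * log_weight x) \<partial>lebesgue)"
proof -
  note [measurable] = lebesgue_measurable_of_borel[OF log_weight_measurable]
  have "orlicz_modular log_measure (young_phi N) u
      = (\<integral>\<^sup>+x. ennreal (log_weight x) * ennreal (young_phi N (u x)) \<partial>lebesgue)"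
    unfolding orlicz_modular_def log_measure_def by (rule nn_integral_density) measurable
  also have "\<dots> = (\<integral>\<^sup>+x. ennreal (phi N (\<bar>u x\<bar> powr (real N / (real N - 1))) * log_weight x) \<partial>lebesgue)"
    by (intro nn_integral_cong)
       (simp add: young_phi_def ennreal_mult' order_trans[OF zero_le_one log_weight_ge_1] mult.commute)
  finally show ?thesis .
qed

text \<open>On the unit ball the modular at level \<open>\<beta>\<close> is at most
  \<open>K\<close>; passing from \<open>\<beta>\<close> to \<open>\<beta> / K\<close> brings it
  below 1 by \<open>phi_contract\<close>, and \<open>C powr p = K / \<beta>\<close> translates this
  into a scaling of \<open>u\<close>.\<close>

lemma luxemburg_norm_bound:
  assumes N: "2 \<le> CARD('n::finite)"
  obtains C :: real where "0 < C"
    and "\<And>u :: real ^ 'n \<Rightarrow> real. u \<in> W1N_w \<Longrightarrow>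
      luxemburg_norm log_measure (young_phi CARD('n)) u \<le> ennreal (C * w_norm u)"
proof -
  let ?N = "CARD('n)"
  define p where "p = real ?N / (real ?N - 1)"
  have p: "0 < p" using N by (simp add: p_def)
  define \<beta> where "\<beta> = alpha_N TYPE('n) / 2"
  have \<beta>: "0 < \<beta>" "\<beta> < alpha_N TYPE('n)" using alpha_N_pos[where 'n = 'n] by (auto simp: \<beta>_def)
  obtain K0 where K0: "\<And>(u :: real ^ 'n \<Rightarrow> real) G. w_limit u G \<Longrightarrow> w_energy u G \<le> 1 \<Longrightarrow>
    (\<integral>\<^sup>+x. ennreal (phi ?N (\<beta> * \<bar>u x\<bar> powr p) * log_weight x) \<partial>lebesgue) \<le> ennreal K0"
    unfolding p_def using w_limit_phi_bound[OF N \<beta>] by blast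
  define K where "K = max 1 K0"
  have K: "1 \<le> K" "ennreal K0 \<le> ennreal K" by (auto simp: K_def intro: ennreal_leI)
  define C where "C = (K / \<beta>) powr (1 / p)"
  have C: "0 < C" "C powr p = K / \<beta>" using K \<beta> p by (auto simp: C_def powr_powr)
  \<comment> \<open>Stated for every positive \<open>\<nu>\<close> above the norm, since dividing by
    \<open>w_norm u\<close> fails when it is 0. The claim follows by letting \<open>\<nu>\<close>
    decrease to \<open>w_norm u\<close>.\<close>
  have lux: "luxemburg_norm log_measure (young_phi ?N) u \<le> ennreal (C * \<nu>)"
    if u: "u \<in> W1N_w" and \<nu>: "0 < \<nu>" "w_norm u \<le> \<nu>" for u :: "real ^ 'n \<Rightarrow> real" and \<nu>
  proof -
    note lim = w_grad_w_limit[OF u]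
    note [measurable] = w_limit_measurable[OF lim] lebesgue_measurable_of_borel[OF log_weight_measurable]
    define v where "v x = (1 / \<nu>) * u x" for x
    have zero: "test_function (\<lambda>x :: real ^ 'n. 0 :: real)"
    proof -
      obtain f :: "real ^ 'n \<Rightarrow> real" where "test_function f" using lim unfolding w_limit_def by blast
      from test_function_lincomb(1)[OF this this, of 0 0] show ?thesis by simp
    qed
    have "w_limit v (\<lambda>x. (1 / \<nu>) *\<^sub>R w_grad u x)"
      using w_limit_lincomb[OF lim zero, of "1 / \<nu>" 0] by (simp add: v_def[abs_def])
    moreover have "w_energy v (\<lambda>x. (1 / \<nu>) *\<^sub>R w_grad u x) \<le> 1"
    proof -
      have "w_energy v (\<lambda>x. (1 / \<nu>) *\<^sub>R w_grad u x) = ennreal (\<bar>1 / \<nu>\<bar> ^ ?N) * ennreal (w_norm u ^ ?N)"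
        unfolding v_def[abs_def] w_energy_w_grad[OF u, symmetric] by (rule w_energy_scale) measurable
      also have "\<dots> = ennreal ((w_norm u / \<nu>) ^ ?N)"
        using \<nu> by (simp add: ennreal_mult'[symmetric] power_divide)
      also have "\<dots> \<le> ennreal 1"
        using \<nu> w_norm_nonneg[of u] by (intro ennreal_leI power_le_one) auto
      finally show ?thesis by simp
    qed
    ultimately have v: "(\<integral>\<^sup>+x. ennreal (phi ?N (\<beta> * \<bar>v x\<bar> powr p) * log_weight x) \<partial>lebesgue) \<le> ennreal K0"
      by (rule K0)
    have vm [measurable]: "v \<in> borel_measurable lebesgue" unfolding v_def[abs_def] by measurable
    have "orlicz_modular log_measure (young_phi ?N) (\<lambda>x. u x / (C * \<nu>))
        = (\<integral>\<^sup>+x. ennreal (phi ?N (\<bar>u x / (C * \<nu>)\<bar> powr p) * log_weight x) \<partial>lebesgue)"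
      unfolding p_def by (rule log_modular_eq) measurable
    also have "\<dots> \<le> (\<integral>\<^sup>+x. ennreal (1 / K) * ennreal (phi ?N (\<beta> * \<bar>v x\<bar> powr p) * log_weight x) \<partial>lebesgue)"
    proof (rule nn_integral_mono)
      fix x :: "real ^ 'n"
      have lw: "0 \<le> log_weight x" using log_weight_ge_1[of x] by linarith
      have "\<bar>u x / (C * \<nu>)\<bar> = \<bar>v x\<bar> / C" using C \<nu> by (simp add: v_def abs_mult)
      then have "\<bar>u x / (C * \<nu>)\<bar> powr p = 1 / K * (\<beta> * \<bar>v x\<bar> powr p)"
        using C K \<beta> by (simp add: powr_divide)
      moreover have "phi ?N (1 / K * (\<beta> * \<bar>v x\<bar> powr p)) \<le> 1 / K * phi ?N (\<beta> * \<bar>v x\<bar> powr p)"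
        using K \<beta> by (intro phi_contract N) auto
      ultimately have "phi ?N (\<bar>u x / (C * \<nu>)\<bar> powr p) \<le> 1 / K * phi ?N (\<beta> * \<bar>v x\<bar> powr p)"
        by (simp only:)
      from mult_right_mono[OF this lw]
      have "ennreal (phi ?N (\<bar>u x / (C * \<nu>)\<bar> powr p) * log_weight x)
          \<le> ennreal (1 / K * (phi ?N (\<beta> * \<bar>v x\<bar> powr p) * log_weight x))"
        by (intro ennreal_leI) (simp only: mult.assoc)
      also have "\<dots> = ennreal (1 / K) * ennreal (phi ?N (\<beta> * \<bar>v x\<bar> powr p) * log_weight x)"
        using K by (intro ennreal_mult') auto
      finally show "ennreal (phi ?N (\<bar>u x / (C * \<nu>)\<bar> powr p) * log_weight x) \<le> \<dots>" .
    qed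
    also have "\<dots> = ennreal (1 / K) * (\<integral>\<^sup>+x. ennreal (phi ?N (\<beta> * \<bar>v x\<bar> powr p) * log_weight x) \<partial>lebesgue)"
      by (rule nn_integral_cmult) measurable
    also have "\<dots> \<le> ennreal (1 / K) * ennreal K"
      by (rule mult_left_mono[OF order_trans[OF v K(2)]]) simp
    also have "\<dots> = 1" using K by (simp add: ennreal_mult'[symmetric])
    finally show ?thesis
      unfolding luxemburg_norm_def using C \<nu> by (intro INF_lower) auto
  qed
  show ?thesis
  proof (rule that[OF C(1)])
    fix u :: "real ^ 'n \<Rightarrow> real" assume u: "u \<in> W1N_w"
    show "luxemburg_norm log_measure (young_phi ?N) u \<le> ennreal (C * w_norm u)"
    proof (rule ennreal_le_epsilon)
      fix e :: real assume "0 < e"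
      have "luxemburg_norm log_measure (young_phi ?N) u \<le> ennreal (C * (w_norm u + e / C))"
        using \<open>0 < e\<close> C w_norm_nonneg[of u] by (intro lux u) (auto intro: add_nonneg_pos)
      also have "C * (w_norm u + e / C) = C * w_norm u + e" using C by (simp add: distrib_left)
      also have "ennreal \<dots> = ennreal (C * w_norm u) + ennreal e"
        using \<open>0 < e\<close> C w_norm_nonneg[of u] by (intro ennreal_plus) auto
      finally show "luxemburg_norm log_measure (young_phi ?N) u \<le> ennreal (C * w_norm u) + ennreal e" .
    qed
  qed
qed

text \<open>The first two conjuncts express the embedding: an inclusion of sets, and its continuity
  as a bound of the Luxemburg norm by the Sobolev norm.\<close>

theorem theorem1p1:
  fixes N :: nat
  assumes "N = CARD('n::finite)" and "N \<ge> 3"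
  shows
    "(W1N_w :: (real ^ 'n \<Rightarrow> real) set) \<subseteq> orlicz_space log_measure (young_phi N) \<and>
     (\<exists>C>0. \<forall>u \<in> (W1N_w :: (real ^ 'n \<Rightarrow> real) set).
        luxemburg_norm log_measure (young_phi N) u \<le> ennreal (C * w_norm u)) \<and>
     (\<forall>u \<in> (W1N_w :: (real ^ 'n \<Rightarrow> real) set). \<forall>\<alpha>>0.
        (\<integral>\<^sup>+ x. ennreal (phi N (\<alpha> * \<bar>u x\<bar> powr (real N / (real N - 1))) * log_weight x)
           \<partial>lebesgue) < \<infinity>) \<and>
     (SUP u \<in> {u \<in> (W1N_w :: (real ^ 'n \<Rightarrow> real) set). w_norm u ^ N \<le> 1}.
        \<integral>\<^sup>+ x. ennreal (phi N (alpha_N TYPE('n) * (real N / (real N + 1)) powr (1 / (real N - 1))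
                            * \<bar>u x\<bar> powr (real N / (real N - 1))) * log_weight x)
           \<partial>lebesgue) < \<infinity>"
proof (intro conjI)
  have N: "2 \<le> CARD('n)" "2 \<le> N" using assms by auto
  have finite: "(\<integral>\<^sup>+x. ennreal (phi N (\<alpha> * \<bar>u x\<bar> powr (real N / (real N - 1))) * log_weight x) \<partial>lebesgue) < \<infinity>"
    if "u \<in> W1N_w" "0 < \<alpha>" for u :: "real ^ 'n \<Rightarrow> real" and \<alpha>
    unfolding assms(1) by (rule w_limit_phi_finite[OF N(1) w_grad_w_limit[OF that(1)] that(2)])
  then show "\<forall>u \<in> (W1N_w :: (real ^ 'n \<Rightarrow> real) set). \<forall>\<alpha>>0.
      (\<integral>\<^sup>+ x. ennreal (phi N (\<alpha> * \<bar>u x\<bar> powr (real N / (real N - 1))) * log_weight x) \<partial>lebesgue) < \<infinity>"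
    by blast
  show "(W1N_w :: (real ^ 'n \<Rightarrow> real) set) \<subseteq> orlicz_space log_measure (young_phi N)"
  proof
    fix u :: "real ^ 'n \<Rightarrow> real" assume u: "u \<in> W1N_w"
    have meas: "u \<in> borel_measurable lebesgue"
      by (rule w_limit_measurable(1)[OF w_grad_w_limit[OF u]])
    have "orlicz_modular log_measure (young_phi N) (\<lambda>x. u x / 1) < \<infinity>"
      using finite[OF u, of 1] log_modular_eq[OF meas] by simp
    moreover have "u \<in> borel_measurable log_measure" using meas by (simp add: log_measure_def)
    ultimately show "u \<in> orlicz_space log_measure (young_phi N)"
      unfolding orlicz_space_def using zero_less_one by blast
  qed
  show "\<exists>C>0. \<forall>u \<in> (W1N_w :: (real ^ 'n \<Rightarrow> real) set).
      luxemburg_norm log_measure (young_phi N) u \<le> ennreal (C * w_norm u)"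
    using luxemburg_norm_bound[OF N(1)] unfolding assms(1) by metis
  define \<beta> where "\<beta> = alpha_N TYPE('n) * (real N / (real N + 1)) powr (1 / (real N - 1))"
  \<comment> \<open>The factor is strictly below 1, so the exponent is subcritical and
    \<open>w_limit_phi_bound\<close> applies.\<close>
  have "(real N / (real N + 1)) powr (1 / (real N - 1)) < 1 powr (1 / (real N - 1))"
    using N by (intro powr_less_mono2) auto
  then have \<beta>: "0 < \<beta>" "\<beta> < alpha_N TYPE('n)"
    using alpha_N_pos[where 'n = 'n] N by (auto simp: \<beta>_def)
  obtain K where K: "\<And>(u :: real ^ 'n \<Rightarrow> real) G. w_limit u G \<Longrightarrow> w_energy u G \<le> 1 \<Longrightarrow>
    (\<integral>\<^sup>+x. ennreal (phi N (\<beta> * \<bar>u x\<bar> powr (real N / (real N - 1))) * log_weight x) \<partial>lebesgue) \<le> ennreal K"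
    unfolding assms(1) using w_limit_phi_bound[OF N(1) \<beta>] by blast
  have "(SUP u \<in> {u \<in> (W1N_w :: (real ^ 'n \<Rightarrow> real) set). w_norm u ^ N \<le> 1}.
      \<integral>\<^sup>+x. ennreal (phi N (\<beta> * \<bar>u x\<bar> powr (real N / (real N - 1))) * log_weight x) \<partial>lebesgue) \<le> ennreal K"
  proof (rule SUP_least)
    fix u :: "real ^ 'n \<Rightarrow> real" assume "u \<in> {u \<in> W1N_w. w_norm u ^ N \<le> 1}"
    then have u: "u \<in> W1N_w" "w_norm u ^ N \<le> 1" by auto
    then have "w_energy u (w_grad u) \<le> 1"
      by (simp add: w_energy_w_grad assms(1) ennreal_le_1)
    with w_grad_w_limit[OF u(1)]
    show "(\<integral>\<^sup>+x. ennreal (phi N (\<beta> * \<bar>u x\<bar> powr (real N / (real N - 1))) * log_weight x) \<partial>lebesgue) \<le> ennreal K"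
      by (rule K)
  qed
  then show "(SUP u \<in> {u \<in> (W1N_w :: (real ^ 'n \<Rightarrow> real) set). w_norm u ^ N \<le> 1}.
        \<integral>\<^sup>+ x. ennreal (phi N (alpha_N TYPE('n) * (real N / (real N + 1)) powr (1 / (real N - 1))
                            * \<bar>u x\<bar> powr (real N / (real N - 1))) * log_weight x)
           \<partial>lebesgue) < \<infinity>"
    unfolding \<beta>_def infinity_ennreal_def by (rule order.strict_trans1) simp
qed

end
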